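(* Let $m\ge1$, $h\ge0$ be integers, $k=h+2$, $n=m+h+1$, and let $z=(z^1,\dots,z^m)^\intercal$, $w=(w^1,\dots,w^h)^\intercal$, $t$ be the coordinates of $\mathbb{C}^n=\mathbb{C}^m\times\mathbb{C}^h\times\mathbb{C}$, with $v=\operatorname{Im}(w)\in\mathbb{R}^h$. Let $H_1,\dots,H_h$ be hermitian symmetric $m\times m$ matrices, $B,C\in\mathbb{C}^{m\times m}$ with $C$ symmetric, $D\in\mathbb{C}^{m\times h}$, and let $M\subset\mathbb{C}^n$ be the quadric $$M:\quad\begin{cases} w^j+\bar w^j=z^*H_jz,&1\le j\le h,\\ t=z^*Bz+\tfrac12z^*C\bar z+z^*Dv,\end{cases}$$ a smooth real submanifold of dimension $2n-k=2m+h$ of $\mathbb{C}^n$. Write $B=F+iG$, $C=P+iQ$, $D=R+iS$ with $F,G,P,Q\in\mathbb{R}^{m\times m}$ and $R,S\in\mathbb{R}^{m\times h}$. A necessary and sufficient condition in order that the Gauss map $\tau:M\ni p\mapsto T_pM\in\mathrm{Gr}^{\mathbb{R}}_{2n-k}(\mathbb{C}^n)$ be transversal to $\mathrm{Gr}_{(m,h)}(\mathbb{C}^n)$ at $0$ is that the real $2m\times(2m+h)$ matrix $$\begin{pmatrix} F+P & Q-G & R \\ G+Q & F-P & S \end{pmatrix}$$ has rank $2m$.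
   Context: $\mathrm{Gr}^{\mathbb{R}}_d(\mathbb{C}^n)$ is the Grassmannian of $d$-dimensional real linear subspaces of $\mathbb{C}^n\simeq\mathbb{R}^{2n}$. For nonnegative integers $m,h$ with $2m+h=d$, $\mathrm{Gr}_{(m,h)}(\mathbb{C}^n)$ is the smooth submanifold of $\mathrm{Gr}^{\mathbb{R}}_d(\mathbb{C}^n)$ consisting of the real $d$-dimensional subspaces $L$ with $\dim_{\mathbb{C}}(L\cap iL)=m$. The affine structure of $\mathbb{C}^n$ is used to regard $T_pM$ as a linear subspace of $\mathbb{C}^n$. Here $T_0M\in\mathrm{Gr}_{(m,h)}(\mathbb{C}^n)$, and $\tau$ is transversal to $\mathrm{Gr}_{(m,h)}(\mathbb{C}^n)$ at $0$ if $d\tau(T_0M)$ and the tangent space of $\mathrm{Gr}_{(m,h)}(\mathbb{C}^n)$ at $T_0M$ together span the tangent space of $\mathrm{Gr}^{\mathbb{R}}_{2n-k}(\mathbb{C}^n)$ at $T_0M$. $z^*$ denotes the conjugate transpose. *)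

theory Defs
  imports
    "HOL-Analysis.Analysis"
    "Jordan_Normal_Form.Schur_Decomposition"
    "Jordan_Normal_Form.DL_Rank"
begin

hide_const (open) Finite_Cartesian_Product.vec
no_notation Finite_Cartesian_Product.vec_nth (infixl "$" 90)

section \<open>Smooth curves and tangent spaces of subsets of a normed space\<close>

text \<open>Only the germ at \<open>0\<close> of a curve matters; \<open>D k\<close> is its \<open>k\<close>-th derivative near \<open>0\<close>.\<close>

definition smooth_curve :: "(real \<Rightarrow> 'a::real_normed_vector) \<Rightarrow> bool" where
  "smooth_curve c \<longleftrightarrow>
     (\<exists>e>0. \<exists>D :: nat \<Rightarrow> real \<Rightarrow> 'a. D 0 = c \<and>
        (\<forall>k. \<forall>s\<in>{-e<..<e}. (D k has_vector_derivative D (Suc k) s) (at s)))"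

definition curve_in :: "'a::real_normed_vector set \<Rightarrow> 'a \<Rightarrow> 'a \<Rightarrow> (real \<Rightarrow> 'a) \<Rightarrow> bool" where
  "curve_in M p \<xi> c \<longleftrightarrow>
     smooth_curve c \<and> c 0 = p \<and> (\<forall>\<^sub>F s in nhds 0. c s \<in> M) \<and>
     (c has_vector_derivative \<xi>) (at 0)"

definition tangent_space :: "'a::real_normed_vector set \<Rightarrow> 'a \<Rightarrow> 'a set" where
  "tangent_space M p = {\<xi>. \<exists>c. curve_in M p \<xi> c}"

section \<open>Real Grassmannians\<close>

definition Grass :: "nat \<Rightarrow> 'a::euclidean_space set set" where
  "Grass d = {L. Real_Vector_Spaces.subspace L \<and> Real_Vector_Spaces.dim L = d}"

text \<open>\<open>vec.dim\<close> is the dimension over the scalar field of the vectors, here the complex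
  numbers, whereas the dimension in \<open>Grass\<close> is taken over the reals.\<close>

definition Grass_CR :: "nat \<Rightarrow> nat \<Rightarrow> (complex^'n) set set" where
  "Grass_CR m h =
     {L \<in> Grass (2 * m + h). vec.dim (L \<inter> (\<lambda>x. \<i> *s x) ` L) = m}"

text \<open>The smooth structure of the Grassmannian is given by the usual graph charts: the
  subspaces meeting the orthogonal complement of \<open>L\<close> trivially are, uniquely, the graphs of the
  linear maps from \<open>L\<close> to that complement. Such a map is extended by \<open>0\<close> on the
  complement, so that \<open>grass_hom L\<close> is a linear space of endomorphisms of the ambient
  space. It is also the tangent space at \<open>L\<close>, read in the chart centred at \<open>L\<close>.\<close>

definition grass_hom :: "'a::euclidean_space set \<Rightarrow> ('a \<Rightarrow>\<^sub>L 'a) set" where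
  "grass_hom L =
     {A. (\<forall>x\<in>L. blinfun_apply A x \<in> orthogonal_comp L) \<and>
         (\<forall>x\<in>orthogonal_comp L. blinfun_apply A x = 0)}"

definition grass_graph :: "'a::euclidean_space set \<Rightarrow> ('a \<Rightarrow>\<^sub>L 'a) \<Rightarrow> 'a set" where
  "grass_graph L A = {x + blinfun_apply A x | x. x \<in> L}"

text \<open>\<open>\<gamma>\<close> is smooth near \<open>0\<close>, with velocity \<open>X\<close> there, in the chart centred at \<open>\<gamma> 0\<close>.\<close>

definition has_grass_velocity ::
  "(real \<Rightarrow> 'a::euclidean_space set) \<Rightarrow> ('a \<Rightarrow>\<^sub>L 'a) \<Rightarrow> bool" where
  "has_grass_velocity \<gamma> X \<longleftrightarrow>
     (\<exists>a. smooth_curve a \<and>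
          (\<forall>\<^sub>F s in nhds 0. a s \<in> grass_hom (\<gamma> 0) \<and> \<gamma> s = grass_graph (\<gamma> 0) (a s)) \<and>
          (a has_vector_derivative X) (at 0))"

definition grass_tangent_space ::
  "'a::euclidean_space set set \<Rightarrow> 'a set \<Rightarrow> ('a \<Rightarrow>\<^sub>L 'a) set" where
  "grass_tangent_space S L =
     {X. \<exists>\<gamma>. \<gamma> 0 = L \<and> (\<forall>\<^sub>F s in nhds 0. \<gamma> s \<in> S) \<and> has_grass_velocity \<gamma> X}"

section \<open>The Gauss map and transversality\<close>

definition gauss_map :: "'a::real_normed_vector set \<Rightarrow> 'a \<Rightarrow> 'a set" where
  "gauss_map M p = tangent_space M p"

definition grass_differential ::
  "'a::euclidean_space set \<Rightarrow> ('a \<Rightarrow> 'a set) \<Rightarrow> 'a \<Rightarrow> 'a \<Rightarrow> ('a \<Rightarrow>\<^sub>L 'a)" where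
  "grass_differential M f p \<xi> =
     (THE X. \<forall>c. curve_in M p \<xi> c \<longrightarrow> has_grass_velocity (f \<circ> c) X)"

text \<open>Meant for \<open>p \<in> M\<close>, for \<open>f\<close> a smooth map from \<open>M\<close> to \<open>Grass d\<close>, and for \<open>S\<close> a
  submanifold of \<open>Grass d\<close> containing \<open>f p\<close>.\<close>

definition grass_transversal_at ::
  "nat \<Rightarrow> 'a::euclidean_space set \<Rightarrow> ('a \<Rightarrow> 'a set) \<Rightarrow> 'a set set \<Rightarrow> 'a \<Rightarrow> bool" where
  "grass_transversal_at d M f S p \<longleftrightarrow>
     Real_Vector_Spaces.span
         (grass_differential M f p ` tangent_space M p \<union> grass_tangent_space S (f p)) =
       grass_tangent_space (Grass d) (f p)"

section \<open>The quadric and the matrix\<close>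

text \<open>\<open>idx\<close> enumerates the index type of the coordinates, in the order
  \<open>z\<^sup>1, \<dots>, z\<^sup>m, w\<^sup>1, \<dots>, w\<^sup>h, t\<close>. Explicit dimensions are used for \<open>z\<close>, \<open>w\<close> and
  the matrices because \<open>h = 0\<close> is allowed and types are not empty.\<close>

definition z_coord :: "(nat \<Rightarrow> 'n) \<Rightarrow> nat \<Rightarrow> complex^'n \<Rightarrow> complex Matrix.vec" where
  "z_coord idx m x = Matrix.vec m (\<lambda>j. vec_nth x (idx j))"

definition w_coord :: "(nat \<Rightarrow> 'n) \<Rightarrow> nat \<Rightarrow> nat \<Rightarrow> complex^'n \<Rightarrow> complex Matrix.vec" where
  "w_coord idx m h x = Matrix.vec h (\<lambda>j. vec_nth x (idx (m + j)))"

definition t_coord :: "(nat \<Rightarrow> 'n) \<Rightarrow> nat \<Rightarrow> nat \<Rightarrow> complex^'n \<Rightarrow> complex" where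
  "t_coord idx m h x = vec_nth x (idx (m + h))"

text \<open>Since \<open>u \<bullet>c z\<close> conjugates its second argument, it is the product of the row \<open>z\<^sup>*\<close> with
  the column \<open>u\<close>. The matrices \<open>H j\<close> are indexed from \<open>0\<close>.\<close>

definition quadric ::
  "(nat \<Rightarrow> 'n) \<Rightarrow> nat \<Rightarrow> nat \<Rightarrow> (nat \<Rightarrow> complex mat) \<Rightarrow> complex mat \<Rightarrow> complex mat \<Rightarrow>
   complex mat \<Rightarrow> (complex^'n) set" where
  "quadric idx m h H B C D =
     {x. let z = z_coord idx m x; w = w_coord idx m h x; t = t_coord idx m h x;
             v = map_vec (\<lambda>a. complex_of_real (Im a)) w
         in (\<forall>j<h. w $ j + cnj (w $ j) = (H j *\<^sub>v z) \<bullet>c z) \<and>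
            t = (B *\<^sub>v z) \<bullet>c z + 1/2 * ((C *\<^sub>v conjugate z) \<bullet>c z) + (D *\<^sub>v v) \<bullet>c z}"

definition append_cols :: "'a::zero mat \<Rightarrow> 'a mat \<Rightarrow> 'a mat" (infixr \<open>@\<^sub>c\<close> 66) where
  "A @\<^sub>c B = four_block_mat A B (0\<^sub>m 0 (dim_col A)) (0\<^sub>m 0 (dim_col B))"

end

theory Submission
  imports Defs
begin

text \<open>Near \<open>0\<close> the quadric is the graph over \<open>T0 = T\<^sub>0M = {Re w = 0, t = 0}\<close> of a map that is
  homogeneous of degree two, so \<open>T\<^sub>pM\<close> is the graph over \<open>T0\<close> of a linear map depending
  linearly on \<open>p\<close>, and the differential of the Gauss map at \<open>0\<close> is this dependence.

  The tangent space of \<open>Grass_CR m h\<close> at \<open>T0\<close> consists of the \<open>X : T0 \<rightarrow> T0\<^sup>\<bottom>\<close> whose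
  \<open>t\<close>-component is complex linear in \<open>z\<close>: the complex span of a space of type \<open>(m, h)\<close> lies in a
  complex hyperplane, so a determinant vanishes along every curve, and conversely every such \<open>X\<close> is
  the velocity of an orbit of complex linear maps. Taking the antilinear part in \<open>z\<close> of the
  \<open>t\<close>-component thus identifies the normal space with \<open>\<complex>\<^sup>m\<close>, and composed with the
  differential of the Gauss map it becomes, up to a factor, \<open>(z, v) \<mapsto> B z + C z' + D v\<close>, where \<open>z'\<close>
  is the conjugate of \<open>z\<close>. Its real matrix is the one in the statement.\<close>

section \<open>Smooth curves\<close>

lemma smooth_curve_bounded_linear:
  assumes f: "bounded_linear f" and c: "smooth_curve c"
  shows "smooth_curve (\<lambda>s. f (c s))"
proof -
  from c obtain e D where e: "e > 0" and D0: "D 0 = c"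
    and D: "\<And>k s. s \<in> {-e<..<e} \<Longrightarrow> (D k has_vector_derivative D (Suc k) s) (at s)"
    unfolding smooth_curve_def by metis
  show ?thesis unfolding smooth_curve_def
    using e D0 bounded_linear.has_vector_derivative[OF f D]
    by (intro exI[of _ e] conjI exI[of _ "\<lambda>k s. f (D k s)"]) auto
qed

lemma quadratic_has_vector_derivative:
  "((\<lambda>s. p + s *\<^sub>R u + s\<^sup>2 *\<^sub>R v) has_vector_derivative u + (2 * s) *\<^sub>R v) (at s)"
  by (auto intro!: derivative_eq_intros)

lemma quadratic_has_vector_derivative_0:
  "((\<lambda>s. p + s *\<^sub>R u + s\<^sup>2 *\<^sub>R v) has_vector_derivative u) (at 0)"
  using quadratic_has_vector_derivative[of p u v 0] by simp

text \<open>The curves constructed explicitly below, on the quadric and in charts of the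
  Grassmannian, are all polynomials of degree at most two.\<close>

lemma smooth_curve_quadratic: "smooth_curve (\<lambda>s. p + s *\<^sub>R u + s\<^sup>2 *\<^sub>R v)"
proof -
  define D where "D k = (case k of 0 \<Rightarrow> \<lambda>s. p + s *\<^sub>R u + s\<^sup>2 *\<^sub>R v
     | Suc 0 \<Rightarrow> \<lambda>s. u + (2 * s) *\<^sub>R v | Suc (Suc 0) \<Rightarrow> \<lambda>s. 2 *\<^sub>R v | _ \<Rightarrow> \<lambda>s::real. 0)" for k
  have "(D k has_vector_derivative D (Suc k) s) (at s)" for k s
    using quadratic_has_vector_derivative[of p u v s]
    by (auto simp: D_def split: nat.splits intro!: derivative_eq_intros)
  then show ?thesis
    unfolding smooth_curve_def by (intro exI[of _ 1] conjI exI[of _ D]) (auto simp: D_def)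
qed

text \<open>Exhibits the velocity as a limit of rescaled points of the curve, so that closed
  conditions stable under scaling pass from the curve to its velocity.\<close>

lemma difference_quotient_tendsto:
  assumes "(a has_vector_derivative X) (at 0)" "a 0 = 0"
  shows "((\<lambda>s. a s /\<^sub>R s) \<longlongrightarrow> X) (at 0)"
proof -
  have "((\<lambda>s. (a s - s *\<^sub>R X) /\<^sub>R \<bar>s\<bar>) \<longlongrightarrow> 0) (at 0)"
    using assms unfolding has_vector_derivative_def has_derivative_def by simp
  then have "((\<lambda>s. norm ((a s - s *\<^sub>R X) /\<^sub>R \<bar>s\<bar>)) \<longlongrightarrow> 0) (at 0)"
    by (rule tendsto_norm_zero)
  \<comment> \<open>The derivative is normalised by \<open>\<bar>s\<bar>\<close> and the quotient by
    \<open>s\<close>; the two differ by a sign, which the norm does not see.\<close>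
  moreover have "\<forall>\<^sub>F s in at 0. norm ((a s - s *\<^sub>R X) /\<^sub>R \<bar>s\<bar>) = norm (a s /\<^sub>R s - X)"
    using eventually_neq_at_within[of 0 0 UNIV]
  proof eventually_elim
    case (elim s)
    then have "a s /\<^sub>R s - X = (a s - s *\<^sub>R X) /\<^sub>R s"
      by (simp add: scaleR_diff_right)
    then show ?case by simp
  qed
  ultimately have "((\<lambda>s. norm (a s /\<^sub>R s - X)) \<longlongrightarrow> 0) (at 0)"
    by (rule Lim_transform_eventually)
  then show ?thesis by (rule LIM_zero_cancel[OF tendsto_norm_zero_cancel])
qed

section \<open>Charts of the Grassmannian\<close>

lemma orthogonal_decomposition:
  fixes L :: "'a::euclidean_space set"
  assumes "Real_Vector_Spaces.subspace L"
  obtains y z where "y \<in> L" "z \<in> orthogonal_comp L" "x = y + z"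
  using subspace_sum_orthogonal_comp[OF assms] by (metis UNIV_I set_plus_elim)

lemma orthogonal_comp_disjoint: "x \<in> L \<Longrightarrow> x \<in> orthogonal_comp L \<Longrightarrow> x = 0"
  unfolding orthogonal_comp_def using orthogonal_self[of x] by blast

lemma subspace_grass_hom: "Real_Vector_Spaces.subspace (grass_hom L)"
  using subspace_orthogonal_comp[of L]
  by (auto simp: Real_Vector_Spaces.subspace_def grass_hom_def blinfun.bilinear_simps)

text \<open>Both defining conditions are preimages of closed sets under evaluation maps, which are
  continuous.\<close>

lemma closed_grass_hom: "closed (grass_hom L)"
proof -
  have eq: "grass_hom L = (\<Inter>x\<in>L. (\<lambda>A. blinfun_apply A x) -` orthogonal_comp L)
      \<inter> (\<Inter>x\<in>orthogonal_comp L. (\<lambda>A. blinfun_apply A x) -` {0})"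
    by (auto simp: grass_hom_def)
  have cont: "continuous_on UNIV (\<lambda>A. blinfun_apply A x)" for x :: 'a
    by (intro continuous_intros)
  show ?thesis unfolding eq
    by (intro closed_Int closed_INT ballI closed_vimage closed_subspace
        subspace_orthogonal_comp closed_singleton cont)
qed

text \<open>Charts are injective: if the two graphs share a point over \<open>y\<close> and
  \<open>y'\<close>, then \<open>y - y'\<close> lies in \<open>L\<close> and in its complement,
  hence vanishes. Off \<open>L\<close> both maps are fixed by being zero on the complement.\<close>

lemma grass_hom_eqI:
  fixes L :: "'a::euclidean_space set"
  assumes L: "Real_Vector_Spaces.subspace L" and A: "A \<in> grass_hom L" and B: "B \<in> grass_hom L"
    and eq: "grass_graph L A = grass_graph L B"
  shows "A = B"
proof (rule blinfun_eqI)
  have *: "blinfun_apply A y = blinfun_apply B y" if "y \<in> L" for y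
  proof -
    have "y + blinfun_apply A y \<in> grass_graph L B"
      using that eq unfolding grass_graph_def by blast
    then obtain y' where y': "y' \<in> L" and e: "y + blinfun_apply A y = y' + blinfun_apply B y'"
      by (auto simp: grass_graph_def)
    have "y - y' \<in> L" using L that y' by (simp add: Real_Vector_Spaces.subspace_diff)
    moreover have "y - y' = blinfun_apply B y' - blinfun_apply A y"
      using e by (simp add: algebra_simps)
    then have "y - y' \<in> orthogonal_comp L"
      using A B that y' by (simp add: grass_hom_def Real_Vector_Spaces.subspace_diff subspace_orthogonal_comp)
    ultimately have "y = y'" using orthogonal_comp_disjoint by fastforce
    with e show ?thesis by simp
  qed
  fix x
  obtain y z where "y \<in> L" "z \<in> orthogonal_comp L" "x = y + z"
    by (rule orthogonal_decomposition[OF L])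
  then show "blinfun_apply A x = blinfun_apply B x"
    using A B * by (simp add: blinfun.add_right grass_hom_def)
qed

lemma grass_graph_0: "grass_graph L 0 = L"
  by (auto simp: grass_graph_def)

lemma zero_in_grass_hom: "0 \<in> grass_hom L"
  using subspace_grass_hom Real_Vector_Spaces.subspace_0 by blast

lemma subspace_grass_graph:
  "Real_Vector_Spaces.subspace L \<Longrightarrow> Real_Vector_Spaces.subspace (grass_graph L A)"
  unfolding grass_graph_def
  using Real_Vector_Spaces.linear_subspace_image[of "\<lambda>x. x + blinfun_apply A x" L]
  by (simp add: image_def linear_iff blinfun.bilinear_simps algebra_simps Setcompr_eq_image)

text \<open>The parametrisation \<open>x + A x\<close> is injective on \<open>L\<close> because
  \<open>A\<close> takes values in the complement of \<open>L\<close>.\<close>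

lemma dim_grass_graph:
  fixes L :: "'a::euclidean_space set"
  assumes L: "Real_Vector_Spaces.subspace L" and A: "A \<in> grass_hom L"
  shows "Real_Vector_Spaces.dim (grass_graph L A) = Real_Vector_Spaces.dim L"
proof -
  let ?f = "\<lambda>x. x + blinfun_apply A x"
  have lin: "linear ?f" by (simp add: linear_iff blinfun.bilinear_simps algebra_simps)
  have "inj_on ?f L"
  proof (rule inj_onI)
    fix x y assume xy: "x \<in> L" "y \<in> L" and e: "?f x = ?f y"
    have "x - y \<in> L" using L xy by (simp add: Real_Vector_Spaces.subspace_diff)
    moreover have "x - y = blinfun_apply A (y - x)"
      using e by (simp add: algebra_simps blinfun.bilinear_simps)
    then have "x - y \<in> orthogonal_comp L"
      using A L xy by (simp add: grass_hom_def Real_Vector_Spaces.subspace_diff)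
    ultimately show "x = y" using orthogonal_comp_disjoint by fastforce
  qed
  then have "inj_on ?f (Real_Vector_Spaces.span L)"
    using L Real_Vector_Spaces.span_eq_iff by metis
  then have "Real_Vector_Spaces.dim (?f ` L) = Real_Vector_Spaces.dim L"
    by (rule dim_image_eq[OF lin])
  then show ?thesis by (simp add: grass_graph_def Setcompr_eq_image)
qed

text \<open>The chart curve starts at zero, since \<open>\<gamma> 0\<close> is over itself the graph
  of both \<open>a 0\<close> and \<open>0\<close>.\<close>

lemma has_grass_velocityE:
  assumes "Real_Vector_Spaces.subspace (\<gamma> 0)" "has_grass_velocity \<gamma> X"
  obtains a where "smooth_curve a" "a 0 = 0" "(a has_vector_derivative X) (at 0)"
    "\<forall>\<^sub>F s in nhds 0. a s \<in> grass_hom (\<gamma> 0) \<and> \<gamma> s = grass_graph (\<gamma> 0) (a s)"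
proof -
  from assms(2) obtain a where a: "smooth_curve a" "(a has_vector_derivative X) (at 0)"
    and ev: "\<forall>\<^sub>F s in nhds 0. a s \<in> grass_hom (\<gamma> 0) \<and> \<gamma> s = grass_graph (\<gamma> 0) (a s)"
    unfolding has_grass_velocity_def by blast
  have "a 0 \<in> grass_hom (\<gamma> 0)" "\<gamma> 0 = grass_graph (\<gamma> 0) (a 0)"
    using eventually_nhds_x_imp_x[OF ev] by auto
  then have "a 0 = 0"
    using grass_hom_eqI[OF assms(1) _ zero_in_grass_hom] by (simp add: grass_graph_0)
  with a ev show ?thesis using that by blast
qed

text \<open>Two chart representations agree near \<open>0\<close> by injectivity of the chart. This
  makes the definite description in \<open>grass_differential\<close> meaningful.\<close>

lemma has_grass_velocity_unique:
  assumes "Real_Vector_Spaces.subspace (\<gamma> 0)" "has_grass_velocity \<gamma> X" "has_grass_velocity \<gamma> Y"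
  shows "X = Y"
proof -
  obtain a where a: "(a has_vector_derivative X) (at 0)" and
    aev: "\<forall>\<^sub>F s in nhds 0. a s \<in> grass_hom (\<gamma> 0) \<and> \<gamma> s = grass_graph (\<gamma> 0) (a s)"
    by (rule has_grass_velocityE[OF assms(1,2)])
  obtain b where b: "(b has_vector_derivative Y) (at 0)" and
    bev: "\<forall>\<^sub>F s in nhds 0. b s \<in> grass_hom (\<gamma> 0) \<and> \<gamma> s = grass_graph (\<gamma> 0) (b s)"
    by (rule has_grass_velocityE[OF assms(1,3)])
  have eq: "\<forall>\<^sub>F s in nhds 0. a s = b s"
    using aev bev by eventually_elim (rule grass_hom_eqI[OF assms(1)], simp_all)
  then have eq0: "a 0 = b 0" by (rule eventually_nhds_x_imp_x)
  have "(b has_vector_derivative X) (at 0)"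
    using a has_vector_derivative_cong_ev[where f = a and g = b and x = 0 and S = UNIV] eq eq0 by simp
  with b show ?thesis using vector_derivative_unique_at by blast
qed

text \<open>A velocity is a limit of difference quotients, all lying in the closed linear space
  \<open>grass_hom L\<close>.\<close>

lemma grass_tangent_space_subset:
  assumes L: "Real_Vector_Spaces.subspace L"
  shows "grass_tangent_space S L \<subseteq> grass_hom L"
proof
  fix X assume "X \<in> grass_tangent_space S L"
  then obtain \<gamma> where "\<gamma> 0 = L" "has_grass_velocity \<gamma> X"
    by (auto simp: grass_tangent_space_def)
  then have sub: "Real_Vector_Spaces.subspace (\<gamma> 0)" using L by simp
  obtain a where a: "a 0 = 0" "(a has_vector_derivative X) (at 0)"
    and ev: "\<forall>\<^sub>F s in nhds 0. a s \<in> grass_hom (\<gamma> 0) \<and> \<gamma> s = grass_graph (\<gamma> 0) (a s)"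
    by (rule has_grass_velocityE[OF sub \<open>has_grass_velocity \<gamma> X\<close>])
  have a3: "\<forall>\<^sub>F s in nhds 0. a s \<in> grass_hom L"
    using ev \<open>\<gamma> 0 = L\<close> by (auto elim: eventually_mono)
  have "\<forall>\<^sub>F s in at 0. a s /\<^sub>R s \<in> grass_hom L"
    using a3 subspace_grass_hom[of L] Real_Vector_Spaces.subspace_scale
    by (auto simp: eventually_at_filter elim!: eventually_mono)
  then show "X \<in> grass_hom L"
    using difference_quotient_tendsto[OF a(2,1)] closed_grass_hom
    by (intro Lim_in_closed_set) auto
qed

lemma grass_tangent_spaceI:
  assumes "smooth_curve a" "(a has_vector_derivative X) (at 0)" "a 0 = 0" "L \<in> S"
    "\<forall>\<^sub>F s in nhds 0. a s \<in> grass_hom L \<and> grass_graph L (a s) \<in> S"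
  shows "X \<in> grass_tangent_space S L"
  unfolding grass_tangent_space_def has_grass_velocity_def
  using assms
  by (auto intro!: exI[of _ "\<lambda>s. grass_graph L (a s)"] exI[of _ a]
      simp: grass_graph_0 elim: eventually_mono)

text \<open>Every direction is attained by a straight line in the chart, because graphs over
  \<open>L\<close> keep the dimension of \<open>L\<close>.\<close>

lemma grass_tangent_space_Grass:
  fixes L :: "'a::euclidean_space set"
  assumes L: "L \<in> Grass d"
  shows "grass_tangent_space (Grass d) L = grass_hom L"
proof
  have sub: "Real_Vector_Spaces.subspace L" and d: "Real_Vector_Spaces.dim L = d"
    using L by (auto simp: Grass_def)
  show "grass_tangent_space (Grass d) L \<subseteq> grass_hom L"
    by (rule grass_tangent_space_subset[OF sub])
  show "grass_hom L \<subseteq> grass_tangent_space (Grass d) L"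
  proof
    fix X assume X: "X \<in> grass_hom L"
    have "s *\<^sub>R X \<in> grass_hom L" for s
      using X subspace_grass_hom Real_Vector_Spaces.subspace_scale by blast
    then show "X \<in> grass_tangent_space (Grass d) L"
      using smooth_curve_quadratic[of 0 X 0] quadratic_has_vector_derivative_0[of 0 X 0] L sub d
      by (intro grass_tangent_spaceI[of "\<lambda>s. s *\<^sub>R X"])
        (auto simp: Grass_def subspace_grass_graph dim_grass_graph)
  qed
qed

section \<open>The Gauss map of a graph over its tangent space\<close>

text \<open>Separates the real differential geometry from the CR structure. Here \<open>proj\<close>
  is the orthogonal projection onto \<open>L\<close>, and since \<open>b\<close> sees only
  projections, the set studied is the graph over \<open>L\<close> of \<open>b y y\<close>. Symmetry
  of \<open>b\<close> is not assumed.\<close>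

locale quadratic_graph = bounded_bilinear b
  for b :: "'a::euclidean_space \<Rightarrow> 'a \<Rightarrow> 'a" +
  fixes L :: "'a set" and proj :: "'a \<Rightarrow> 'a"
  assumes sub: "Real_Vector_Spaces.subspace L"
    and linear_proj: "linear proj"
    and proj_in: "proj x \<in> L"
    and proj_id: "x \<in> L \<Longrightarrow> proj x = x"
    and proj_ortho: "x - proj x \<in> orthogonal_comp L"
    and b_ortho: "b x y \<in> orthogonal_comp L"
    and b_proj: "b (proj x) (proj y) = b x y"
begin

definition graph_set :: "'a set" where "graph_set = {x. x - proj x = b x x}"

text \<open>The derivative at \<open>p\<close> of \<open>b x x\<close>. As a bilinear expression in
  \<open>p\<close> and its argument it is the second fundamental form of \<open>graph_set\<close> at
  \<open>0\<close>.\<close>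

definition shape :: "'a \<Rightarrow> 'a \<Rightarrow>\<^sub>L 'a" where "shape p = prod_right p + prod_left p"

lemma shape_apply: "blinfun_apply (shape p) x = b p x + b x p"
  by (simp add: shape_def blinfun.add_left)

lemma bounded_linear_shape: "bounded_linear shape"
  unfolding shape_def[abs_def]
  by (intro bounded_linear_add bounded_linear_prod_left bounded_linear_prod_right)

lemma proj_comp: assumes "x \<in> orthogonal_comp L" shows "proj x = 0"
proof -
  have "x - (x - proj x) \<in> orthogonal_comp L"
    using subspace_orthogonal_comp assms proj_ortho by (rule Real_Vector_Spaces.subspace_diff)
  then show ?thesis using proj_in[of x] orthogonal_comp_disjoint by fastforce
qed

lemma b_proj_left: "b (proj x) y = b x y"
  using b_proj[of "proj x" y] b_proj[of x y] proj_id[OF proj_in[of x]] by simp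

lemma b_proj_right: "b x (proj y) = b x y"
  using b_proj[of x "proj y"] b_proj[of x y] proj_id[OF proj_in[of y]] by simp

lemma shape_in_grass_hom: "shape p \<in> grass_hom L"
proof -
  have "b p x + b x p \<in> orthogonal_comp L" for x
    using subspace_orthogonal_comp b_ortho b_ortho by (rule Real_Vector_Spaces.subspace_add)
  moreover have "b p x + b x p = 0" if "x \<in> orthogonal_comp L" for x
    using proj_comp[OF that] b_proj_right[of p x] b_proj_left[of x p] by (simp add: zero_left zero_right)
  ultimately show ?thesis by (simp add: grass_hom_def shape_apply)
qed

text \<open>One inclusion differentiates the equation \<open>c = proj c + b c c\<close> along a
  curve; the other lifts a line in \<open>L\<close> to the graph.\<close>

lemma tangent_space_graph_set:
  assumes p: "p \<in> graph_set"
  shows "tangent_space graph_set p = grass_graph L (shape p)"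
proof (intro equalityI subsetI)
  fix \<xi> assume "\<xi> \<in> tangent_space graph_set p"
  then obtain c where c0: "c 0 = p" and d: "(c has_vector_derivative \<xi>) (at 0)"
    and ev: "\<forall>\<^sub>F s in nhds 0. c s \<in> graph_set"
    by (auto simp: tangent_space_def curve_in_def)
  have bp: "bounded_linear proj"
    using linear_proj by (simp add: linear_conv_bounded_linear)
  have d2: "((\<lambda>s. proj (c s) + b (c s) (c s)) has_vector_derivative proj \<xi> + (b p \<xi> + b \<xi> p)) (at 0)"
    using has_vector_derivative[OF d d] c0
    by (intro has_vector_derivative_add bounded_linear.has_vector_derivative[OF bp d]) simp
  have ev': "\<forall>\<^sub>F s in nhds 0. c s = proj (c s) + b (c s) (c s)"
    using ev by eventually_elim (simp add: graph_set_def algebra_simps)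
  have "(c has_vector_derivative proj \<xi> + (b p \<xi> + b \<xi> p)) (at 0)"
    using d2 has_vector_derivative_cong_ev[where f = c and g = "\<lambda>s. proj (c s) + b (c s) (c s)"
        and x = 0 and S = UNIV] ev' eventually_nhds_x_imp_x[OF ev'] by simp
  with d have "\<xi> = proj \<xi> + (b p \<xi> + b \<xi> p)"
    using vector_derivative_unique_at by blast
  then have "\<xi> = proj \<xi> + blinfun_apply (shape p) (proj \<xi>)"
    by (simp add: shape_apply b_proj_left b_proj_right)
  then show "\<xi> \<in> grass_graph L (shape p)"
    unfolding grass_graph_def using proj_in by blast
next
  fix \<xi> assume "\<xi> \<in> grass_graph L (shape p)"
  then obtain y where y: "y \<in> L" and \<xi>: "\<xi> = y + (b p y + b y p)"
    by (auto simp: grass_graph_def shape_apply)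
  \<comment> \<open>The lift to the graph of the line \<open>proj p + s *\<^sub>R y\<close>; the
    quadratic term keeps it exactly on the graph.\<close>
  define c where "c s = p + s *\<^sub>R \<xi> + s\<^sup>2 *\<^sub>R b y y" for s
  have projc: "proj (c s) = proj p + s *\<^sub>R y" for s
    using y by (simp add: c_def \<xi> linear_add[OF linear_proj] linear_scale[OF linear_proj]
        proj_comp[OF b_ortho] proj_id)
  have "b (c s) (c s) = b p p + s *\<^sub>R (b p y + b y p) + s\<^sup>2 *\<^sub>R b y y" for s
  proof -
    have "b (c s) (c s) = b (proj p + s *\<^sub>R y) (proj p + s *\<^sub>R y)"
      using b_proj[of "c s" "c s"] projc by simp
    also have "\<dots> = b p p + s *\<^sub>R (b p y + b y p) + s\<^sup>2 *\<^sub>R b y y"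
      by (simp add: add_left add_right scaleR_left scaleR_right b_proj_left b_proj_right
          algebra_simps power2_eq_square)
    finally show ?thesis .
  qed
  then have "c s \<in> graph_set" for s
    using p projc[of s] by (simp add: graph_set_def c_def \<xi> algebra_simps)
  then have "curve_in graph_set p \<xi> c"
    using smooth_curve_quadratic[of p \<xi> "b y y"] quadratic_has_vector_derivative_0[of p \<xi> "b y y"]
    by (simp add: curve_in_def c_def[abs_def])
  then show "\<xi> \<in> tangent_space graph_set p" by (auto simp: tangent_space_def)
qed

lemma zero_in_graph_set: "0 \<in> graph_set"
  using linear_0[OF linear_proj] by (simp add: graph_set_def zero_left)

lemma tangent_space_0: "tangent_space graph_set 0 = L"
proof -
  have "shape 0 = 0" using bounded_linear_shape by (rule linear_simps)
  then show ?thesis using tangent_space_graph_set[OF zero_in_graph_set] by (simp add: grass_graph_0)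
qed

text \<open>In the chart centred at \<open>L\<close> the Gauss map along \<open>c\<close> is exactly
  \<open>shape (c s)\<close>. As \<open>shape\<close> is linear, it only has to be applied to the
  velocity of \<open>c\<close>.\<close>

lemma gauss_map_velocity:
  assumes c: "curve_in graph_set 0 \<xi> c"
  shows "has_grass_velocity (gauss_map graph_set \<circ> c) (shape \<xi>)"
proof -
  from c have c0: "c 0 = 0" and d: "(c has_vector_derivative \<xi>) (at 0)"
    and ev: "\<forall>\<^sub>F s in nhds 0. c s \<in> graph_set" and sm: "smooth_curve c"
    by (auto simp: curve_in_def)
  have "\<forall>\<^sub>F s in nhds 0. shape (c s) \<in> grass_hom L \<and>
      (gauss_map graph_set \<circ> c) s = grass_graph L (shape (c s))"
    using ev by eventually_elim (simp add: shape_in_grass_hom gauss_map_def tangent_space_graph_set)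
  moreover have "(gauss_map graph_set \<circ> c) 0 = L"
    by (simp add: c0 gauss_map_def tangent_space_0)
  ultimately show ?thesis
    unfolding has_grass_velocity_def
    using smooth_curve_bounded_linear[OF bounded_linear_shape sm]
      bounded_linear.has_vector_derivative[OF bounded_linear_shape d]
    by (intro exI[of _ "\<lambda>s. shape (c s)"]) simp
qed

text \<open>A curve through \<open>0\<close> with velocity \<open>\<xi>\<close> exists because
  \<open>L\<close> is the tangent space; uniqueness of velocities then determines the described
  object.\<close>

lemma grass_differential_gauss_map:
  assumes "\<xi> \<in> L"
  shows "grass_differential graph_set (gauss_map graph_set) 0 \<xi> = shape \<xi>"
proof -
  from assms obtain c where c: "curve_in graph_set 0 \<xi> c"
    using tangent_space_0 by (auto simp: tangent_space_def)
  then have s: "Real_Vector_Spaces.subspace ((gauss_map graph_set \<circ> c) 0)"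
    by (simp add: curve_in_def gauss_map_def tangent_space_0 sub)
  show ?thesis unfolding grass_differential_def
    using gauss_map_velocity has_grass_velocity_unique[OF s _ gauss_map_velocity[OF c]] c
    by (intro the_equality) auto
qed

end

section \<open>Transversality to a kernel as surjectivity\<close>

text \<open>Here \<open>f\<close> serves as the projection to the normal space: a subspace spans
  \<open>V\<close> together with the kernel exactly when it surjects onto the quotient.\<close>

lemma span_Un_kernel_eq_iff:
  assumes V: "Real_Vector_Spaces.subspace V" and S: "Real_Vector_Spaces.subspace S" "S \<subseteq> V"
    and f: "linear f"
  shows "Real_Vector_Spaces.span (S \<union> {x\<in>V. f x = 0}) = V \<longleftrightarrow> f ` S = f ` V"
proof -
  have K: "Real_Vector_Spaces.subspace {x\<in>V. f x = 0}"
    using V f by (auto simp: Real_Vector_Spaces.subspace_def linear_add linear_scale linear_0)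
  have span: "Real_Vector_Spaces.span (S \<union> {x\<in>V. f x = 0}) = {x + y |x y. x \<in> S \<and> y \<in> {x\<in>V. f x = 0}}"
    using S(1) K by (simp add: Real_Vector_Spaces.span_Un Real_Vector_Spaces.span_eq_iff[THEN iffD2])
  show ?thesis
  proof
    assume *: "Real_Vector_Spaces.span (S \<union> {x\<in>V. f x = 0}) = V"
    have "f x \<in> f ` S" if x: "x \<in> V" for x
    proof -
      obtain y z where "y \<in> S" "f z = 0" "x = y + z" using x * span by blast
      then show ?thesis using linear_add[OF f, of y z] by simp
    qed
    then show "f ` S = f ` V" using S(2) by blast
  next
    assume *: "f ` S = f ` V"
    have "x \<in> Real_Vector_Spaces.span (S \<union> {x\<in>V. f x = 0})" if x: "x \<in> V" for x
    proof -
      obtain y where y: "y \<in> S" "f x = f y" using * x by blast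
      then have "f (x - y) = 0" by (simp add: linear_diff[OF f])
      moreover have "x - y \<in> V" using V x y S(2) by (meson Real_Vector_Spaces.subspace_diff subsetD)
      moreover have "x = y + (x - y)" by simp
      ultimately show ?thesis unfolding span using y(1) by blast
    qed
    moreover have "Real_Vector_Spaces.span (S \<union> {x\<in>V. f x = 0}) \<subseteq> V"
      using S(2) V by (intro Real_Vector_Spaces.span_minimal) auto
    ultimately show "Real_Vector_Spaces.span (S \<union> {x\<in>V. f x = 0}) = V" by blast
  qed
qed

notation vec_nth (infixl "$h" 90)

section \<open>Real and complex subspaces\<close>

lemma scaleR_eq_vector_scalar: "r *\<^sub>R x = complex_of_real r *s (x :: complex^'n)"
  by (simp add: Finite_Cartesian_Product.vec_eq_iff complex_eq_iff)

lemma linear_ii: "linear (\<lambda>x::complex^'n. \<i> *s x)"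
  by (simp add: linear_iff vec.scale_right_distrib scaleR_eq_vector_scalar mult.commute)

lemma inj_ii: "inj (\<lambda>x::complex^'n. \<i> *s x)"
  by (simp add: inj_def)

lemma complex_subspaceI:
  fixes S :: "(complex^'n) set"
  assumes S: "Real_Vector_Spaces.subspace S" and i: "\<And>x. x \<in> S \<Longrightarrow> \<i> *s x \<in> S"
  shows "vec.subspace S"
proof (rule vec.subspaceI)
  fix c x assume x: "x \<in> S"
  have "c *s x = Re c *\<^sub>R x + Im c *\<^sub>R (\<i> *s x)"
    by (simp add: Finite_Cartesian_Product.vec_eq_iff complex_eq_iff)
  also have "\<dots> \<in> S"
    using S x i by (intro Real_Vector_Spaces.subspace_add Real_Vector_Spaces.subspace_scale) auto
  finally show "c *s x \<in> S" .
qed (use S in \<open>auto simp: Real_Vector_Spaces.subspace_0 Real_Vector_Spaces.subspace_add\<close>)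

text \<open>Separate index sets for real and imaginary parts cover both complex coordinate subspaces
  (\<open>J = K\<close>) and the tangent space of the quadric, where \<open>w\<close> contributes
  imaginary parts only.\<close>

lemma real_dim_coordinate_subspace:
  fixes J K :: "'n::finite set"
  shows "Real_Vector_Spaces.dim {x::complex^'n. (\<forall>i. i \<notin> J \<longrightarrow> Re (x $h i) = 0) \<and> (\<forall>i. i \<notin> K \<longrightarrow> Im (x $h i) = 0)}
    = card J + card K"
proof -
  let ?d = "(\<lambda>i. axis i 1) ` J \<union> (\<lambda>i. axis i \<i>) ` K :: (complex^'n) set"
  have inj: "inj_on (\<lambda>i. axis i c) A" if "c \<noteq> 0" for A :: "'n set" and c :: complex
    using that by (auto simp: inj_on_def axis_eq_axis)
  have "card ?d = card ((\<lambda>i. axis i (1::complex)) ` J) + card ((\<lambda>i. axis i \<i>) ` K)"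
    by (rule card_Un_disjoint) (auto simp: axis_eq_axis)
  also have "\<dots> = card J + card K" by (simp add: card_image inj)
  finally have card: "card ?d = card J + card K" .
  have sub: "?d \<subseteq> Basis" by (auto simp: Basis_vec_def Basis_complex_def)
  have eq: "{x::complex^'n. (\<forall>i. i \<notin> J \<longrightarrow> Re (x $h i) = 0) \<and> (\<forall>i. i \<notin> K \<longrightarrow> Im (x $h i) = 0)}
      = {x. \<forall>i\<in>Basis. i \<notin> ?d \<longrightarrow> x \<bullet> i = 0}"
  proof (intro Collect_cong iffI conjI ballI allI impI)
    fix x :: "complex^'n" and b
    assume *: "(\<forall>i. i \<notin> J \<longrightarrow> Re (x $h i) = 0) \<and> (\<forall>i. i \<notin> K \<longrightarrow> Im (x $h i) = 0)"
      and b: "b \<in> Basis" "b \<notin> ?d"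
    from b(1) consider i where "b = axis i 1" | i where "b = axis i \<i>"
      by (auto simp: Basis_vec_def Basis_complex_def)
    then show "x \<bullet> b = 0"
      by cases (use * b(2) in \<open>auto simp: inner_axis inner_complex_def\<close>)
  next
    fix x :: "complex^'n" and i
    assume *: "\<forall>i\<in>Basis. i \<notin> ?d \<longrightarrow> x \<bullet> i = 0" and i: "i \<notin> J"
    have "axis i 1 \<notin> ?d" using i by (auto simp: axis_eq_axis)
    moreover have "axis i 1 \<in> (Basis :: (complex^'n) set)" by (auto simp: Basis_vec_def Basis_complex_def)
    ultimately have "x \<bullet> axis i 1 = 0" using * by blast
    then show "Re (x $h i) = 0" by (simp add: inner_axis inner_complex_def)
  next
    fix x :: "complex^'n" and i
    assume *: "\<forall>i\<in>Basis. i \<notin> ?d \<longrightarrow> x \<bullet> i = 0" and i: "i \<notin> K"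
    have "axis i \<i> \<notin> ?d" using i by (auto simp: axis_eq_axis)
    moreover have "axis i \<i> \<in> (Basis :: (complex^'n) set)" by (auto simp: Basis_vec_def Basis_complex_def)
    ultimately have "x \<bullet> axis i \<i> = 0" using * by blast
    then show "Im (x $h i) = 0" by (simp add: inner_axis inner_complex_def)
  qed
  show ?thesis unfolding eq card[symmetric] by (rule dim_substandard[OF sub])
qed

lemma complex_linear_imp_linear:
  "Vector_Spaces.linear (*s) (*s) (f :: complex^'n \<Rightarrow> complex^'m) \<Longrightarrow> linear f"
  by (simp add: linear_iff scaleR_eq_vector_scalar vec.linear_add vec.linear_scale)

text \<open>A complex isomorphism with a coordinate subspace is also real linear, so the count can
  be made there.\<close>

lemma real_dim_complex_subspace:
  fixes U :: "(complex^'n) set"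
  assumes U: "vec.subspace U"
  shows "Real_Vector_Spaces.dim U = 2 * vec.dim U"
proof -
  have "vec.dim U \<le> CARD('n)" using vec.dim_subset_UNIV[of U] vec.dim_UNIV
    by (simp add: vec.dimension_def card_cart_basis)
  then obtain J :: "'n set" where J: "card J = vec.dim U"
    using obtain_subset_with_card_n by metis
  let ?S = "{x::complex^'n. \<forall>i. i \<notin> J \<longrightarrow> x $h i = 0}"
  have S: "vec.subspace ?S" by (auto simp: vec.subspace_def)
  have "vec.dim ?S = vec.dim U" using J by (simp add: dim_substandard_cart)
  then obtain f where f: "Vector_Spaces.linear (*s) (*s) f" "f ` ?S = U" "inj_on f ?S"
    using vec.subspace_isomorphism[OF S U] by blast
  have sub: "Real_Vector_Spaces.subspace ?S" by (auto simp: Real_Vector_Spaces.subspace_def)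
  have "inj_on f (Real_Vector_Spaces.span ?S)"
    by (simp only: Real_Vector_Spaces.span_eq_iff[THEN iffD2, OF sub] f(3))
  then have "Real_Vector_Spaces.dim (f ` ?S) = Real_Vector_Spaces.dim ?S"
    by (rule dim_image_eq[OF complex_linear_imp_linear[OF f(1)]])
  then have "Real_Vector_Spaces.dim U = Real_Vector_Spaces.dim ?S" by (simp only: f(2))
  also have "?S = {x. (\<forall>i. i \<notin> J \<longrightarrow> Re (x $h i) = 0) \<and> (\<forall>i. i \<notin> J \<longrightarrow> Im (x $h i) = 0)}"
    by (auto simp: complex_eq_iff)
  finally show ?thesis using J by (simp add: real_dim_coordinate_subspace)
qed

text \<open>Injective complex linear maps commute with multiplication by \<open>\<i>\<close> and
  hence preserve the type. Curves in \<open>Grass_CR\<close> are built from this.\<close>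

lemma Grass_CR_image:
  fixes L :: "(complex^'n) set"
  assumes L: "L \<in> Grass_CR m h" and g: "Vector_Spaces.linear (*s) (*s) g" "inj g"
  shows "g ` L \<in> Grass_CR m h"
proof -
  have sub: "Real_Vector_Spaces.subspace L" and d: "Real_Vector_Spaces.dim L = 2 * m + h"
    and c: "vec.dim (L \<inter> (\<lambda>x. \<i> *s x) ` L) = m"
    using L by (auto simp: Grass_CR_def Grass_def)
  have lin: "linear g" using g(1) by (rule complex_linear_imp_linear)
  have "(\<lambda>x. \<i> *s x) ` (g ` L) = g ` ((\<lambda>x. \<i> *s x) ` L)"
    by (simp add: image_image vec.linear_scale[OF g(1)])
  then have "g ` L \<inter> (\<lambda>x. \<i> *s x) ` (g ` L) = g ` (L \<inter> (\<lambda>x. \<i> *s x) ` L)"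
    by (simp add: image_Int[OF g(2)])
  then have "vec.dim (g ` L \<inter> (\<lambda>x. \<i> *s x) ` (g ` L)) = m"
    using c vec.dim_image_eq[OF g(1) inj_on_subset[OF g(2) subset_UNIV]] by simp
  moreover have "Real_Vector_Spaces.dim (g ` L) = 2 * m + h"
    using d dim_image_eq[OF lin inj_on_subset[OF g(2) subset_UNIV]] by metis
  ultimately show ?thesis
    using Real_Vector_Spaces.linear_subspace_image[OF lin sub] by (simp add: Grass_CR_def Grass_def)
qed

text \<open>The sum \<open>L + \<i> L\<close> has real dimension
  \<open>2 * (2 * m + h) - 2 * m = 2 * (m + h)\<close>, two less than that of the ambient
  space.\<close>

lemma Grass_CR_complex_span_proper:
  fixes L :: "(complex^'n) set"
  assumes L: "L \<in> Grass_CR m h" and n: "CARD('n) = m + h + 1"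
  shows "{x + \<i> *s y |x y. x \<in> L \<and> y \<in> L} \<noteq> UNIV"
proof
  let ?iL = "(\<lambda>x. \<i> *s x) ` L"
  assume "{x + \<i> *s y |x y. x \<in> L \<and> y \<in> L} = UNIV"
  moreover have "{x + \<i> *s y |x y. x \<in> L \<and> y \<in> L} = {x + y |x y. x \<in> L \<and> y \<in> ?iL}"
    by blast
  ultimately have U: "{x + y |x y. x \<in> L \<and> y \<in> ?iL} = UNIV" by simp
  have sub: "Real_Vector_Spaces.subspace L" and d: "Real_Vector_Spaces.dim L = 2 * m + h"
    and c: "vec.dim (L \<inter> ?iL) = m"
    using L by (auto simp: Grass_CR_def Grass_def)
  have subi: "Real_Vector_Spaces.subspace ?iL"
    using linear_ii sub by (rule Real_Vector_Spaces.linear_subspace_image)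
  have di: "Real_Vector_Spaces.dim ?iL = 2 * m + h"
    using d dim_image_eq[OF linear_ii inj_on_subset[OF inj_ii subset_UNIV]] by metis
  have "vec.subspace (L \<inter> ?iL)"
  proof (rule complex_subspaceI)
    show "Real_Vector_Spaces.subspace (L \<inter> ?iL)"
      using sub subi by (rule Real_Vector_Spaces.subspace_inter)
    fix x assume "x \<in> L \<inter> ?iL"
    then obtain y where "x \<in> L" "y \<in> L" "x = \<i> *s y" by blast
    moreover from this have "\<i> *s x = - y" by (simp add: Finite_Cartesian_Product.vec_eq_iff)
    ultimately have "\<i> *s x \<in> L" using sub by (simp add: Real_Vector_Spaces.subspace_neg)
    with \<open>x \<in> L\<close> show "\<i> *s x \<in> L \<inter> ?iL" by blast
  qed
  then have "Real_Vector_Spaces.dim (L \<inter> ?iL) = 2 * m" using c by (simp add: real_dim_complex_subspace)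
  then have "Real_Vector_Spaces.dim (UNIV :: (complex^'n) set) + 2 * m = 2 * (2 * m + h)"
    using dim_sums_Int[OF sub subi] d di U by simp
  then show False using n by simp
qed

lemma subspace_complex_span:
  fixes L :: "(complex^'n) set"
  assumes L: "Real_Vector_Spaces.subspace L"
  shows "vec.subspace {x + \<i> *s y |x y. x \<in> L \<and> y \<in> L}"
proof (rule vec.subspaceI)
  show "0 \<in> {x + \<i> *s y |x y. x \<in> L \<and> y \<in> L}"
    using Real_Vector_Spaces.subspace_0[OF L] by (auto intro!: exI[of _ 0])
next
  fix u v assume "u \<in> {x + \<i> *s y |x y. x \<in> L \<and> y \<in> L}" "v \<in> {x + \<i> *s y |x y. x \<in> L \<and> y \<in> L}"
  then obtain x y x' y' where "x \<in> L" "y \<in> L" "x' \<in> L" "y' \<in> L" "u = x + \<i> *s y" "v = x' + \<i> *s y'"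
    by blast
  moreover from this have "u + v = (x + x') + \<i> *s (y + y')" by (simp add: vec.scale_right_distrib)
  ultimately show "u + v \<in> {x + \<i> *s y |x y. x \<in> L \<and> y \<in> L}"
    using Real_Vector_Spaces.subspace_add[OF L] by blast
next
  fix c u assume "u \<in> {x + \<i> *s y |x y. x \<in> L \<and> y \<in> L}"
  then obtain x y where xy: "x \<in> L" "y \<in> L" and u: "u = x + \<i> *s y" by blast
  have "c *s u = (Re c *\<^sub>R x - Im c *\<^sub>R y) + \<i> *s (Im c *\<^sub>R x + Re c *\<^sub>R y)"
    by (simp add: u Finite_Cartesian_Product.vec_eq_iff complex_eq_iff algebra_simps)
  moreover have "Re c *\<^sub>R x - Im c *\<^sub>R y \<in> L" "Im c *\<^sub>R x + Re c *\<^sub>R y \<in> L"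
    using xy L by (auto intro: Real_Vector_Spaces.subspace_diff Real_Vector_Spaces.subspace_add
        Real_Vector_Spaces.subspace_scale)
  ultimately show "c *s u \<in> {x + \<i> *s y |x y. x \<in> L \<and> y \<in> L}" by blast
qed

section \<open>Determinants as closed equations for degenerate spans\<close>

lemma det_rows_in_proper_subspace:
  fixes A :: "'a::field^'n^'n"
  assumes U: "vec.subspace U" "U \<noteq> UNIV" and A: "\<And>i. A $h i \<in> U"
  shows "Determinants.det A = 0"
proof (rule ccontr)
  assume "Determinants.det A \<noteq> 0"
  then have "vec.span (Finite_Cartesian_Product.rows A) = UNIV"
    using Determinants.invertible_det_nz invertible_left_inverse matrix_left_invertible_span_rows_gen
    by blast
  moreover have "Finite_Cartesian_Product.rows A \<subseteq> U"
    using A by (auto simp: Finite_Cartesian_Product.rows_def Finite_Cartesian_Product.row_def)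
  ultimately show False using vec.span_minimal[OF _ U(1)] U(2) by blast
qed

lemma tendsto_det:
  fixes A :: "'b \<Rightarrow> complex^'n^'n"
  assumes "\<And>i. ((\<lambda>s. A s $h i) \<longlongrightarrow> B $h i) F"
  shows "((\<lambda>s. Determinants.det (A s)) \<longlongrightarrow> Determinants.det B) F"
  unfolding Determinants.det_def
  by (intro tendsto_sum tendsto_mult tendsto_const tendsto_prod tendsto_vec_nth[OF assms])

section \<open>The tangent space of the CR Grassmannian\<close>

text \<open>\<open>Z\<close>, \<open>W\<close> and \<open>t\<close> are the indices of the
  coordinates \<open>z\<close>, \<open>w\<close> and \<open>t\<close>. Using subsets of the index
  type instead of a numbering allows \<open>W\<close> to be empty.\<close>

locale cr_splitting =
  fixes Z W :: "'n::finite set" and t :: 'n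
  assumes part: "Z \<union> W \<union> {t} = UNIV" "Z \<inter> W = {}" "t \<notin> Z" "t \<notin> W"
begin

lemma index_cases: obtains "i \<in> Z" "i \<notin> W" "i \<noteq> t" | "i \<in> W" "i \<notin> Z" "i \<noteq> t" | "i = t" "i \<notin> Z" "i \<notin> W"
  using part by blast

lemma card_index: "CARD('n) = card Z + card W + 1"
proof -
  have "CARD('n) = card (Z \<union> W \<union> {t})" using part(1) by simp
  also have "\<dots> = card (Z \<union> W) + 1" using part(3,4) by simp
  also have "card (Z \<union> W) = card Z + card W" using part by (intro card_Un_disjoint) auto
  finally show ?thesis .
qed

definition T0 :: "(complex^'n) set" where
  "T0 = {x. (\<forall>i\<in>W. Re (x $h i) = 0) \<and> x $h t = 0}"

lemma subspace_T0: "Real_Vector_Spaces.subspace T0"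
  by (auto simp: T0_def Real_Vector_Spaces.subspace_def)

lemma orthogonal_comp_T0:
  "orthogonal_comp T0 = {x. (\<forall>i\<in>Z. x $h i = 0) \<and> (\<forall>i\<in>W. Im (x $h i) = 0)}"
proof (intro equalityI subsetI CollectI conjI ballI)
  fix x i assume x: "x \<in> orthogonal_comp T0"
  {
    assume i: "i \<in> Z"
    \<comment> \<open>Testing \<open>x\<close> against its own \<open>i\<close>-th component yields
      the squared modulus of that component. For \<open>i\<close> in \<open>W\<close> only its
      imaginary part is available as a test vector.\<close>
    then have "axis i (x $h i) \<in> T0" using part by (auto simp: T0_def axis_def)
    then have "axis i (x $h i) \<bullet> x = 0" using x by (auto simp: orthogonal_comp_def real_inner_class.orthogonal_def)
    then show "x $h i = 0" by (simp add: inner_axis' inner_axis)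
  next
    assume i: "i \<in> W"
    then have "axis i (\<i> * Im (x $h i)) \<in> T0" using part by (auto simp: T0_def axis_def)
    then have "axis i (\<i> * Im (x $h i)) \<bullet> x = 0" using x by (auto simp: orthogonal_comp_def real_inner_class.orthogonal_def)
    then show "Im (x $h i) = 0" by (simp add: inner_axis' inner_complex_def)
  }
next
  fix x :: "complex^'n" assume x: "x \<in> {x. (\<forall>i\<in>Z. x $h i = 0) \<and> (\<forall>i\<in>W. Im (x $h i) = 0)}"
  have "y \<bullet> x = 0" if y: "y \<in> T0" for y
  proof -
    have "y $h i \<bullet> x $h i = 0" for i
      by (cases rule: index_cases[of i]) (use x y in \<open>auto simp: T0_def inner_complex_def\<close>)
    then show ?thesis by (simp add: inner_vec_def)
  qed
  then show "x \<in> orthogonal_comp T0" by (auto simp: orthogonal_comp_def real_inner_class.orthogonal_def)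
qed

text \<open>Real parts are free over \<open>Z\<close> and imaginary parts over
  \<open>Z \<union> W\<close>; the maximal complex subspace is the \<open>z\<close>-space.\<close>

lemma T0_in_Grass_CR: "T0 \<in> Grass_CR (card Z) (card W)"
proof -
  have "T0 = {x. (\<forall>i. i \<notin> Z \<longrightarrow> Re (x $h i) = 0) \<and> (\<forall>i. i \<notin> Z \<union> W \<longrightarrow> Im (x $h i) = 0)}"
    unfolding T0_def using part by (intro Collect_cong) (auto simp: complex_eq_iff)
  then have "Real_Vector_Spaces.dim T0 = card Z + card (Z \<union> W)"
    by (simp only: real_dim_coordinate_subspace)
  also have "card (Z \<union> W) = card Z + card W" using part by (intro card_Un_disjoint) auto
  finally have "Real_Vector_Spaces.dim T0 = 2 * card Z + card W" by simp
  moreover have "T0 \<inter> (\<lambda>x. \<i> *s x) ` T0 = {x. \<forall>i. i \<notin> Z \<longrightarrow> x $h i = 0}"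
  proof (intro equalityI subsetI CollectI allI impI)
    fix x i assume "x \<in> T0 \<inter> (\<lambda>x. \<i> *s x) ` T0" "i \<notin> Z"
    then show "x $h i = 0"
      by (cases rule: index_cases[of i]) (auto simp: T0_def complex_eq_iff)
  next
    fix x :: "complex^'n" assume x: "x \<in> {x. \<forall>i. i \<notin> Z \<longrightarrow> x $h i = 0}"
    have "x = \<i> *s ((- \<i>) *s x)" by (simp add: Finite_Cartesian_Product.vec_eq_iff)
    moreover have "x \<in> T0" "(- \<i>) *s x \<in> T0" using x part by (auto simp: T0_def)
    ultimately show "x \<in> T0 \<inter> (\<lambda>x. \<i> *s x) ` T0" by blast
  qed
  ultimately show ?thesis
    using subspace_T0 by (simp add: Grass_CR_def Grass_def dim_substandard_cart)
qed

text \<open>A matrix \<open>R s\<close> is assembled from rows in the complex span of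
  \<open>\<gamma> s\<close>, a proper subspace, so its determinant vanishes for small nonzero
  \<open>s\<close>. The rows are chosen to have a limit \<open>R0\<close> whose degeneracy is the
  claim.\<close>

lemma Grass_CR_velocity_antilinear_part:
  assumes X: "X \<in> grass_tangent_space (Grass_CR (card Z) (card W)) T0" and i: "i \<in> Z"
  shows "blinfun_apply X (axis i \<i>) $h t = \<i> * blinfun_apply X (axis i 1) $h t"
proof -
  obtain \<gamma> where \<gamma>0: "\<gamma> 0 = T0" and \<gamma>: "\<forall>\<^sub>F s in nhds 0. \<gamma> s \<in> Grass_CR (card Z) (card W)"
    and v: "has_grass_velocity \<gamma> X"
    using X by (auto simp: grass_tangent_space_def)
  have "Real_Vector_Spaces.subspace (\<gamma> 0)" using \<gamma>0 subspace_T0 by simp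
  then obtain a where a: "a 0 = 0" "(a has_vector_derivative X) (at 0)"
    and ev: "\<forall>\<^sub>F s in nhds 0. a s \<in> grass_hom (\<gamma> 0) \<and> \<gamma> s = grass_graph (\<gamma> 0) (a s)"
    using v by (rule has_grass_velocityE)
  have lim: "((\<lambda>s. a s /\<^sub>R s) \<longlongrightarrow> X) (at 0)" using a(2,1) by (rule difference_quotient_tendsto)
  have "isCont a 0" using a(2) by (rule has_vector_derivative_continuous)
  then have lim0: "(a \<longlongrightarrow> 0) (at 0)" using a(1) by (simp add: isCont_def)
  \<comment> \<open>In the row \<open>t\<close> the leading terms cancel, as
    \<open>axis i \<i>\<close> is \<open>\<i>\<close> times \<open>axis i 1\<close>. What remains is
    of first order, and division by \<open>s\<close> leaves a limit that involves the velocity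
    \<open>X\<close>.\<close>
  define R where "R s = (\<chi> k. if k = t
      then blinfun_apply (a s /\<^sub>R s) (axis i \<i>) - \<i> *s blinfun_apply (a s /\<^sub>R s) (axis i 1)
      else if k \<in> Z then axis k 1 + blinfun_apply (a s) (axis k 1)
      else axis k \<i> + blinfun_apply (a s) (axis k \<i>))" for s
  define R0 where "R0 = (\<chi> k. if k = t
      then blinfun_apply X (axis i \<i>) - \<i> *s blinfun_apply X (axis i 1)
      else if k \<in> Z then axis k 1 else axis k \<i>)"
  have "((\<lambda>s. R s $h k) \<longlongrightarrow> R0 $h k) (at 0)" for k
  proof -
    have "((\<lambda>s. blinfun_apply (a s /\<^sub>R s) (axis i \<i>) - \<i> *s blinfun_apply (a s /\<^sub>R s) (axis i 1))
        \<longlongrightarrow> blinfun_apply X (axis i \<i>) - \<i> *s blinfun_apply X (axis i 1)) (at 0)"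
      using linear_ii by (intro tendsto_diff blinfun.tendsto lim tendsto_const
         bounded_linear.tendsto[of "\<lambda>x. \<i> *s x"]) (auto simp: linear_conv_bounded_linear)
    moreover have "((\<lambda>s. axis k c + blinfun_apply (a s) (axis k c)) \<longlongrightarrow> axis k c) (at 0)" for c
      using tendsto_add[OF tendsto_const blinfun.tendsto[OF lim0 tendsto_const]] by (simp add: blinfun.zero_left)
    ultimately show ?thesis unfolding R_def R0_def by simp
  qed
  then have "((\<lambda>s. Determinants.det (R s)) \<longlongrightarrow> Determinants.det R0) (at 0)" by (rule tendsto_det)
  moreover have "\<forall>\<^sub>F s in at 0. Determinants.det (R s) = 0"
    using filter_leD[OF at_within_le_nhds \<gamma>] filter_leD[OF at_within_le_nhds ev]
      eventually_neq_at_within[of 0 0 UNIV]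
  proof eventually_elim
    case (elim s)
    let ?U = "{x + \<i> *s y |x y. x \<in> \<gamma> s \<and> y \<in> \<gamma> s}"
    have sub: "Real_Vector_Spaces.subspace (\<gamma> s)" using elim(1) by (simp add: Grass_CR_def Grass_def)
    have mem: "y + blinfun_apply (a s) y \<in> \<gamma> s" if "y \<in> T0" for y
      using that elim(2) \<gamma>0 by (auto simp: grass_graph_def)
    have mem0: "y + blinfun_apply (a s) y \<in> ?U" if "y \<in> T0" for y
    proof -
      have "y + blinfun_apply (a s) y = (y + blinfun_apply (a s) y) + \<i> *s 0" by simp
      then show ?thesis using mem[OF that] Real_Vector_Spaces.subspace_0[OF sub] by blast
    qed
    have axis_T0: "axis k 1 \<in> T0" "axis k \<i> \<in> T0" if "k \<in> Z" for k
      using that part by (auto simp: T0_def axis_def)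
    have "R s $h k \<in> ?U" for k
    proof (cases rule: index_cases[of k])
      case 1
      then show ?thesis using mem0[OF axis_T0(1)] by (simp add: R_def)
    next
      case 2
      then have "axis k \<i> \<in> T0" using part by (auto simp: T0_def axis_def)
      then show ?thesis using 2 mem0 by (simp add: R_def)
    next
      case 3
      \<comment> \<open>Restoring the cancelled axis vectors shows that this row is a complex
        combination of elements of \<open>\<gamma> s\<close>.\<close>
      let ?y = "\<lambda>c. (1 / s) *\<^sub>R (axis i c + blinfun_apply (a s) (axis i c))"
      have "R s $h k = ?y \<i> + \<i> *s (- ?y 1)"
        using 3 by (simp add: R_def Finite_Cartesian_Product.vec_eq_iff axis_def blinfun.scaleR_left
            algebra_simps inverse_eq_divide)
      moreover have "?y \<i> \<in> \<gamma> s" "- ?y 1 \<in> \<gamma> s"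
        using mem[OF axis_T0(1)[OF i]] mem[OF axis_T0(2)[OF i]] sub
        by (blast intro: Real_Vector_Spaces.subspace_scale Real_Vector_Spaces.subspace_neg)+
      ultimately show ?thesis by blast
    qed
    then show ?case
      using Grass_CR_complex_span_proper[OF elim(1) card_index]
      by (intro det_rows_in_proper_subspace[OF subspace_complex_span[OF sub]])
  qed
  ultimately have "Determinants.det R0 = 0"
    using tendsto_const_iff[of "at (0::real)" 0 "Determinants.det R0"] tendsto_cong by fastforce
  \<comment> \<open>Instead of expanding the determinant, take a kernel vector: the rows other than
    \<open>t\<close> are nonzero multiples of unit vectors and kill all its entries except the one
    at \<open>t\<close>, so the diagonal entry at \<open>t\<close> is zero.\<close>
  then have "\<not> (\<forall>c. R0 *v c = 0 \<longrightarrow> c = 0)"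
    using Determinants.invertible_det_nz[of R0] invertible_left_inverse[of R0]
      matrix_left_invertible_ker[of R0] by metis
  then obtain c where c: "R0 *v c = 0" "c \<noteq> 0" by blast
  have ck: "(\<Sum>l\<in>UNIV. R0 $h k $h l * c $h l) = 0" for k
    using arg_cong[OF c(1), of "\<lambda>v. v $h k"] by (simp add: matrix_vector_mult_def)
  have c0: "c $h k = 0" if "k \<noteq> t" for k
  proof -
    have "(\<Sum>l\<in>UNIV. R0 $h k $h l * c $h l)
        = (\<Sum>l\<in>UNIV. if l = k then (if k \<in> Z then 1 else \<i>) * c $h k else 0)"
      using that by (intro sum.cong) (auto simp: R0_def axis_def)
    then show ?thesis using ck[of k] by (simp split: if_splits)
  qed
  have "c $h t \<noteq> 0"
  proof
    assume "c $h t = 0"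
    then have "c $h k = 0" for k using c0[of k] by (cases "k = t") auto
    then show False using c(2) by (simp add: Finite_Cartesian_Product.vec_eq_iff)
  qed
  moreover have "(\<Sum>l\<in>UNIV. R0 $h t $h l * c $h l) = R0 $h t $h t * c $h t"
    using c0 by (subst sum.remove[of _ t]) (auto intro!: sum.neutral)
  ultimately have "R0 $h t $h t = 0" using ck[of t] by simp
  then show ?thesis by (simp add: R0_def)
qed

end

section \<open>The converse inclusion and the normal space\<close>

context cr_splitting
begin

definition zpart :: "complex^'n \<Rightarrow> complex^'n" where
  "zpart x = (\<chi> i. if i \<in> Z then x $h i else 0)"

definition wpart :: "complex^'n \<Rightarrow> complex^'n" where
  "wpart x = (\<chi> i. if i \<in> W then x $h i else 0)"

text \<open>The factor \<open>\<i>\<close> moves the real part into \<open>T0\<close>, so that the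
  \<open>w\<close>-part of \<open>x\<close> becomes \<open>im_w x - \<i> *s re_w x\<close> with both
  vectors in \<open>T0\<close>.\<close>

definition re_w :: "complex^'n \<Rightarrow> complex^'n" where
  "re_w x = (\<chi> i. if i \<in> W then \<i> * Re (x $h i) else 0)"

definition im_w :: "complex^'n \<Rightarrow> complex^'n" where
  "im_w x = (\<chi> i. if i \<in> W then \<i> * Im (x $h i) else 0)"

lemma linear_parts: "linear zpart" "linear wpart" "linear re_w" "linear im_w"
  by (auto simp: linear_iff zpart_def wpart_def re_w_def im_w_def Finite_Cartesian_Product.vec_eq_iff
      complex_eq_iff algebra_simps)

text \<open>Both sides are real linear in \<open>x\<close>, so the real basis suffices; at
  \<open>axis i \<i>\<close> the claim is the hypothesis multiplied by \<open>\<i>\<close>.\<close>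

lemma antilinear_part_vanishes:
  assumes X: "\<And>i. i \<in> Z \<Longrightarrow> blinfun_apply X (axis i \<i>) $h t = \<i> * blinfun_apply X (axis i 1) $h t"
  shows "blinfun_apply X (\<i> *s zpart x) $h t = \<i> * blinfun_apply X (zpart x) $h t"
proof -
  let ?f = "\<lambda>x. blinfun_apply X (\<i> *s zpart x) $h t" and ?g = "\<lambda>x. \<i> * blinfun_apply X (zpart x) $h t"
  have "linear ?f" "linear ?g"
    using linear_parts(1) linear_ii[where 'n = 'n]
    by (simp_all add: linear_iff blinfun.bilinear_simps algebra_simps)
  moreover have "?f b = ?g b" if "b \<in> Basis" for b
  proof -
    from that obtain i c where b: "b = axis i c" and c: "c = 1 \<or> c = \<i>"
      by (auto simp: Basis_vec_def Basis_complex_def)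
    have ii: "\<i> *s (axis i 1 :: complex^'n) = axis i \<i>" "\<i> *s (axis i \<i> :: complex^'n) = - axis i 1"
      by (simp_all add: Finite_Cartesian_Product.vec_eq_iff axis_def)
    have z: "zpart (axis i c) = (if i \<in> Z then axis i c else 0)"
      by (auto simp: zpart_def Finite_Cartesian_Product.vec_eq_iff axis_def)
    show ?thesis
      using c X[of i] by (auto simp: b z ii blinfun.minus_right blinfun.zero_right)
  qed
  ultimately have "?f = ?g" by (rule linear_eq_stdbasis)
  then show ?thesis by (rule fun_cong)
qed

lemma grass_hom_T0_component:
  assumes "X \<in> grass_hom T0" "x \<in> T0"
  shows "i \<in> Z \<Longrightarrow> blinfun_apply X x $h i = 0" "i \<in> W \<Longrightarrow> Im (blinfun_apply X x $h i) = 0"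
  using assms by (auto simp: grass_hom_def orthogonal_comp_T0)

lemma parts_in_T0: "zpart x \<in> T0" "\<i> *s zpart x \<in> T0" "re_w x \<in> T0" "im_w x \<in> T0"
  using part by (auto simp: T0_def zpart_def re_w_def im_w_def)

lemma parts_ii:
  "zpart (\<i> *s x) = \<i> *s zpart x" "re_w (\<i> *s x) = - im_w x" "im_w (\<i> *s x) = re_w x"
  by (auto simp: zpart_def re_w_def im_w_def Finite_Cartesian_Product.vec_eq_iff)

text \<open>If the antilinear part of \<open>X\<close> vanishes, then \<open>X\<close> is the velocity of the curve
  \<open>s \<mapsto> (1 + s E) T0\<close>, where \<open>E\<close> is the complex linear map whose restriction to \<open>T0\<close> is \<open>X - N\<close>;
  the correction \<open>N\<close> has values in \<open>T0\<close> and does not affect the velocity.\<close>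

lemma Grass_CR_velocityI:
  assumes X: "X \<in> grass_hom T0"
    and lin: "\<And>i. i \<in> Z \<Longrightarrow> blinfun_apply X (axis i \<i>) $h t = \<i> * blinfun_apply X (axis i 1) $h t"
  shows "X \<in> grass_tangent_space (Grass_CR (card Z) (card W)) T0"
proof -
  note simps = linear_iff[THEN iffD1, OF linear_parts(1)] linear_iff[THEN iffD1, OF linear_parts(2)]
    linear_iff[THEN iffD1, OF linear_parts(3)] linear_iff[THEN iffD1, OF linear_parts(4)]
    linear_iff[THEN iffD1, OF linear_ii[where 'n = 'n]] blinfun.bilinear_simps
  let ?X = "blinfun_apply X"
  \<comment> \<open>On \<open>T0\<close> the \<open>w\<close>-components of \<open>X\<close> are
    real. A real-valued real linear \<open>r\<close> is completed to the complex linear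
    \<open>r z - \<i> * r (\<i> * z)\<close>, and \<open>N\<close> is the part subtracted.\<close>
  define N where "N x = \<i> *s wpart (?X (\<i> *s zpart x))" for x
  \<comment> \<open>The extension to all \<open>w\<close> by complex linearity uses the
    decomposition of the \<open>w\<close>-part into \<open>im_w\<close> and
    \<open>re_w\<close>.\<close>
  define E where "E x = ?X (zpart x) - N x + ?X (im_w x) - \<i> *s ?X (re_w x)" for x
  have linN: "linear N" unfolding N_def by (simp add: linear_iff simps)
  have linE: "linear E"
    using linear_iff[THEN iffD1, OF linN] unfolding E_def
    by (simp add: linear_iff simps algebra_simps)
  have N_T0: "N x \<in> T0" for x
    using grass_hom_T0_component[OF X parts_in_T0(2)] part by (auto simp: T0_def N_def wpart_def)
  have z_N: "zpart (N x) = 0" for x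
    using part by (auto simp: zpart_def N_def wpart_def Finite_Cartesian_Product.vec_eq_iff)
  \<comment> \<open>\<open>N\<close> reads only \<open>z\<close> and writes only \<open>w\<close>.
    Hence \<open>1 + s N\<close> maps \<open>T0\<close> onto itself, with inverse
    \<open>1 - s N\<close>.\<close>
  have N_N: "N (N x) = 0" for x
    using linear_0[OF linear_parts(2)] by (simp add: N_def[of "N x"] z_N blinfun.zero_right)
  have E_T0: "E x = ?X x - N x" if "x \<in> T0" for x
  proof -
    have "re_w x = 0" using that by (auto simp: T0_def re_w_def Finite_Cartesian_Product.vec_eq_iff)
    moreover have "zpart x + im_w x = x"
    proof -
      have "(zpart x + im_w x) $h i = x $h i" for i
        by (cases rule: index_cases[of i])
          (use that in \<open>auto simp: T0_def zpart_def im_w_def complex_eq_iff\<close>)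
      then show ?thesis by (simp add: Finite_Cartesian_Product.vec_eq_iff)
    qed
    then have "?X (zpart x) + ?X (im_w x) = ?X x" by (simp flip: blinfun.add_right)
    ultimately show ?thesis by (simp add: E_def blinfun.zero_right algebra_simps)
  qed
  \<comment> \<open>The \<open>w\<close>-components are complex linear by the choice of
    \<open>N\<close>; the \<open>t\<close>-component needs the vanishing of the antilinear
    part.\<close>
  have E_ii: "E (\<i> *s x) = \<i> *s E x" for x
  proof -
    have "\<i> *s (\<i> *s y) = - y" for y :: "complex^'n"
      by (simp add: Finite_Cartesian_Product.vec_eq_iff)
    then have ii: "?X (\<i> *s (\<i> *s zpart x)) = - ?X (zpart x)" by (simp add: blinfun.minus_right)
    have "E (\<i> *s x) $h i = (\<i> *s E x) $h i" for i
      by (cases rule: index_cases[of i])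
        (use grass_hom_T0_component[OF X parts_in_T0(1), of i x] grass_hom_T0_component[OF X parts_in_T0(2), of i x]
            grass_hom_T0_component[OF X parts_in_T0(3), of i x] grass_hom_T0_component[OF X parts_in_T0(4), of i x]
            antilinear_part_vanishes[OF lin, of x]
          in \<open>simp_all add: E_def N_def parts_ii ii wpart_def blinfun.minus_right algebra_simps\<close>)
    then show ?thesis by (simp add: Finite_Cartesian_Product.vec_eq_iff)
  qed
  define g where "g s x = x + s *\<^sub>R E x" for s x
  have g_linear: "Vector_Spaces.linear (*s) (*s) (g s)" for s
    unfolding Vector_Spaces.linear_iff
  proof (intro conjI allI vec.vector_space_axioms)
    show "g s (x + y) = g s x + g s y" for x y
      by (simp add: g_def linear_add[OF linE] algebra_simps)
    fix c x
    have "c *s x = Re c *\<^sub>R x + Im c *\<^sub>R (\<i> *s x)" "c *s E x = Re c *\<^sub>R E x + Im c *\<^sub>R (\<i> *s E x)"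
      by (simp_all add: Finite_Cartesian_Product.vec_eq_iff complex_eq_iff)
    then have "E (c *s x) = c *s E x"
      by (simp add: linear_add[OF linE] linear_scale[OF linE] E_ii)
    then show "g s (c *s x) = c *s g s x"
      by (simp add: g_def vec.scale_right_distrib scaleR_eq_vector_scalar vec.scale_left_commute)
  qed
  obtain K where K: "K > 0" "\<And>x. norm (E x) \<le> K * norm x"
    using linear_bounded_pos[OF linE] by blast
  have g_inj: "inj (g s)" if "\<bar>s\<bar> < 1 / K" for s
  proof -
    have "x = 0" if "g s x = 0" for x
    proof (rule ccontr)
      assume x: "x \<noteq> 0"
      have "x = - (s *\<^sub>R E x)" using that by (simp add: g_def eq_neg_iff_add_eq_0)
      then have "norm x = \<bar>s\<bar> * norm (E x)" by (metis norm_minus_cancel norm_scaleR)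
      also have "\<dots> \<le> \<bar>s\<bar> * (K * norm x)" using K(2) by (intro mult_left_mono) auto
      also have "\<dots> = (\<bar>s\<bar> * K) * norm x" by simp
      also have "\<dots> < 1 * norm x"
        using \<open>\<bar>s\<bar> < 1 / K\<close> K(1) x by (intro mult_strict_right_mono) (auto simp: field_simps)
      finally show False by simp
    qed
    then show ?thesis using vec.linear_inj_iff_eq_0[OF g_linear] by blast
  qed
  \<comment> \<open>The second-order term of the chart curve: on \<open>T0\<close> one has
    \<open>(1 + s E) (1 + s N) = 1 + s X + s\<^sup>2 X N\<close>, because \<open>E = X - N\<close>
    there and \<open>N\<close> squares to zero.\<close>
  define Y where "Y = X o\<^sub>L Blinfun N"
  have Y: "blinfun_apply Y x = ?X (N x)" for x
    using linN by (simp add: Y_def bounded_linear_Blinfun_apply linear_conv_bounded_linear)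
  have "Y \<in> grass_hom T0"
  proof -
    have "N x = 0" if "x \<in> orthogonal_comp T0" for x
    proof -
      have "zpart x = 0" using that
        by (simp add: orthogonal_comp_T0 zpart_def Finite_Cartesian_Product.vec_eq_iff)
      then show ?thesis using linear_0[OF linear_parts(2)] by (simp add: N_def blinfun.zero_right)
    qed
    then show ?thesis using X N_T0 by (simp add: grass_hom_def Y blinfun.zero_right)
  qed
  then have a_hom: "0 + s *\<^sub>R X + s\<^sup>2 *\<^sub>R Y \<in> grass_hom T0" for s
    using X subspace_grass_hom[of T0] zero_in_grass_hom[of T0]
    by (intro Real_Vector_Spaces.subspace_add Real_Vector_Spaces.subspace_scale) auto
  have graph: "grass_graph T0 (0 + s *\<^sub>R X + s\<^sup>2 *\<^sub>R Y) = g s ` T0" for s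
  proof -
    have *: "g s (y + s *\<^sub>R N y) = y + blinfun_apply (0 + s *\<^sub>R X + s\<^sup>2 *\<^sub>R Y) y" if y: "y \<in> T0" for y
    proof -
      have "y + s *\<^sub>R N y \<in> T0" using subspace_T0 y N_T0
        by (intro Real_Vector_Spaces.subspace_add Real_Vector_Spaces.subspace_scale)
      then show ?thesis
        by (simp add: g_def E_T0 linear_add[OF linN] linear_scale[OF linN] N_N Y blinfun.bilinear_simps
            algebra_simps power2_eq_square)
    qed
    have "(\<lambda>y. y + s *\<^sub>R N y) ` T0 = T0"
    proof (intro equalityI subsetI)
      fix x assume "x \<in> T0"
      then have "x - s *\<^sub>R N x \<in> T0" using subspace_T0 N_T0
        by (intro Real_Vector_Spaces.subspace_diff Real_Vector_Spaces.subspace_scale)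
      moreover have "x = (x - s *\<^sub>R N x) + s *\<^sub>R N (x - s *\<^sub>R N x)"
        by (simp add: linear_diff[OF linN] linear_scale[OF linN] N_N)
      ultimately show "x \<in> (\<lambda>y. y + s *\<^sub>R N y) ` T0" by blast
    next
      fix x assume "x \<in> (\<lambda>y. y + s *\<^sub>R N y) ` T0"
      then show "x \<in> T0" using subspace_T0 N_T0
        by (auto intro: Real_Vector_Spaces.subspace_add Real_Vector_Spaces.subspace_scale)
    qed
    then have "g s ` T0 = (\<lambda>y. g s (y + s *\<^sub>R N y)) ` T0" by (metis image_image)
    also have "\<dots> = (\<lambda>y. y + blinfun_apply (0 + s *\<^sub>R X + s\<^sup>2 *\<^sub>R Y) y) ` T0"
      using * by (rule image_cong[OF refl])
    finally show ?thesis by (simp add: grass_graph_def Setcompr_eq_image)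
  qed
  have "\<forall>\<^sub>F s in nhds (0::real). \<bar>s\<bar> < 1 / K"
    using K(1) by (intro eventually_nhds_metric[THEN iffD2] exI[of _ "1 / K"]) (simp add: dist_real_def)
  then have "\<forall>\<^sub>F s in nhds 0. 0 + s *\<^sub>R X + s\<^sup>2 *\<^sub>R Y \<in> grass_hom T0 \<and>
      grass_graph T0 (0 + s *\<^sub>R X + s\<^sup>2 *\<^sub>R Y) \<in> Grass_CR (card Z) (card W)"
    by eventually_elim (use a_hom graph Grass_CR_image[OF T0_in_Grass_CR g_linear g_inj] in \<open>simp only: simp_thms\<close>)
  then show ?thesis
    by (intro grass_tangent_spaceI[OF smooth_curve_quadratic[of 0 X Y] quadratic_has_vector_derivative_0 _ T0_in_Grass_CR])
      simp_all
qed

text \<open>The entry at \<open>i\<close> is \<open>- 2 * \<i>\<close> times the coefficient of the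
  conjugate of \<open>z\<^sup>i\<close> in the \<open>t\<close>-component of
  \<open>X\<close>.\<close>

definition antilinear_part :: "(complex^'n) \<Rightarrow>\<^sub>L (complex^'n) \<Rightarrow> complex^'n" where
  "antilinear_part X = (\<chi> i. if i \<in> Z
     then blinfun_apply X (axis i \<i>) $h t - \<i> * blinfun_apply X (axis i 1) $h t else 0)"

lemma linear_antilinear_part: "linear antilinear_part"
  by (simp add: linear_iff antilinear_part_def Finite_Cartesian_Product.vec_eq_iff
      blinfun.bilinear_simps algebra_simps)

text \<open>The kernel form is the one required by \<open>span_Un_kernel_eq_iff\<close>.\<close>

lemma grass_tangent_space_Grass_CR:
  "grass_tangent_space (Grass_CR (card Z) (card W)) T0 = {X \<in> grass_hom T0. antilinear_part X = 0}"
proof -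
  have "antilinear_part X = 0 \<longleftrightarrow>
      (\<forall>i\<in>Z. blinfun_apply X (axis i \<i>) $h t = \<i> * blinfun_apply X (axis i 1) $h t)" for X
    by (auto simp: antilinear_part_def Finite_Cartesian_Product.vec_eq_iff)
  then show ?thesis
    using Grass_CR_velocity_antilinear_part Grass_CR_velocityI
      subsetD[OF grass_tangent_space_subset[OF subspace_T0]] by blast
qed

lemma antilinear_part_image: "antilinear_part ` grass_hom T0 = {c. \<forall>i. i \<notin> Z \<longrightarrow> c $h i = 0}"
proof (intro equalityI subsetI)
  fix c assume c: "c \<in> {c :: complex^'n. \<forall>i. i \<notin> Z \<longrightarrow> c $h i = 0}"
  \<comment> \<open>A purely antilinear preimage; the coefficient \<open>\<i> / 2\<close> inverts
    the factor \<open>- 2 * \<i>\<close> of \<open>antilinear_part\<close>.\<close>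
  define f where "f x = axis t (\<Sum>i\<in>Z. cnj (x $h i) * (\<i> / 2 * c $h i))" for x :: "complex^'n"
  have "linear f"
  proof (rule Real_Vector_Spaces.linearI)
    show "f (x + y) = f x + f y" for x y
      by (simp add: f_def Finite_Cartesian_Product.vec_eq_iff axis_def distrib_right
          add_divide_distrib sum.distrib)
    show "f (r *\<^sub>R x) = r *\<^sub>R f x" for r x
      by (simp add: f_def Finite_Cartesian_Product.vec_eq_iff axis_def scaleR_sum_right)
        (simp add: scaleR_conv_of_real)
  qed
  then have f: "blinfun_apply (Blinfun f) = f"
    by (simp add: bounded_linear_Blinfun_apply linear_conv_bounded_linear)
  have "Blinfun f \<in> grass_hom T0"
    using part by (auto simp: grass_hom_def f orthogonal_comp_T0 f_def axis_def
        Finite_Cartesian_Product.vec_eq_iff)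
  moreover have "antilinear_part (Blinfun f) = c"
  proof -
    have comp: "f (axis i u) $h t = cnj u * (\<i> / 2 * c $h i)" if "i \<in> Z" for i u
    proof -
      have "f (axis i u) $h t = (\<Sum>j\<in>Z. cnj (axis i u $h j) * (\<i> / 2 * c $h j))"
        by (simp add: f_def)
      also have "\<dots> = (\<Sum>j\<in>Z. if j = i then cnj u * (\<i> / 2 * c $h i) else 0)"
        by (intro sum.cong) (auto simp: axis_def)
      finally show ?thesis using that by simp
    qed
    have "antilinear_part (Blinfun f) $h i = c $h i" for i
      using c by (cases "i \<in> Z") (simp_all add: antilinear_part_def f comp)
    then show ?thesis by (simp add: Finite_Cartesian_Product.vec_eq_iff)
  qed
  ultimately show "c \<in> antilinear_part ` grass_hom T0" by blast
qed (auto simp: antilinear_part_def)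

end

section \<open>Transversality for quadrics\<close>

locale cr_quadric = cr_splitting Z W t
  for Z W :: "'n::finite set" and t :: 'n +
  fixes Hm :: "'n \<Rightarrow> 'n \<Rightarrow> 'n \<Rightarrow> complex" and Bm Cm Dm :: "'n \<Rightarrow> 'n \<Rightarrow> complex"
  assumes Cm_sym: "i \<in> Z \<Longrightarrow> j \<in> Z \<Longrightarrow> Cm i j = Cm j i"
begin

definition t_coeff :: "complex^'n \<Rightarrow> 'n \<Rightarrow> complex" where
  "t_coeff y j = (\<Sum>k\<in>Z. Bm j k * y $h k) + 1/2 * (\<Sum>k\<in>Z. Cm j k * cnj (y $h k))
     + (\<Sum>k\<in>W. Dm j k * of_real (Im (y $h k)))"

text \<open>The right-hand sides of the quadric equations made bilinear: the conjugated factor reads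
  \<open>x\<close> and the rest reads \<open>y\<close>. The halved real part appears because
  \<open>w\<close> plus its conjugate is twice the real part.\<close>

definition form :: "complex^'n \<Rightarrow> complex^'n \<Rightarrow> complex^'n" where
  "form x y = (\<chi> i. if i \<in> W then of_real (Re (\<Sum>j\<in>Z. cnj (x $h j) * (\<Sum>k\<in>Z. Hm i j k * y $h k)) / 2)
     else if i = t then \<Sum>j\<in>Z. cnj (x $h j) * t_coeff y j else 0)"

definition T0_proj :: "complex^'n \<Rightarrow> complex^'n" where "T0_proj x = zpart x + im_w x"

lemma T0_proj_component:
  "T0_proj x $h i = (if i \<in> Z then x $h i else if i \<in> W then \<i> * Im (x $h i) else 0)"
  using part by (auto simp: T0_proj_def zpart_def im_w_def)

lemma bilinear_form: "bilinear form"
proof -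
  have t1: "t_coeff (x + y) j = t_coeff x j + t_coeff y j" for x y j
    by (simp add: t_coeff_def distrib_left sum.distrib add_divide_distrib)
  have t2: "t_coeff (r *\<^sub>R y) j = r *\<^sub>R t_coeff y j" for r y j
  proof -
    have "Dm j k * complex_of_real (r * Im (y $h k)) = r *\<^sub>R (Dm j k * of_real (Im (y $h k)))" for k
      by (simp add: scaleR_conv_of_real)
    then show ?thesis by (simp add: t_coeff_def scaleR_sum_right scaleR_add_right)
  qed
  show ?thesis unfolding bilinear_def
  proof (intro conjI allI Real_Vector_Spaces.linearI)
    show "form x (y + y') = form x y + form x y'" for x y y'
      by (simp add: form_def Finite_Cartesian_Product.vec_eq_iff t1 distrib_left sum.distrib add_divide_distrib)
    show "form (x + x') y = form x y + form x' y" for x x' y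
      by (simp add: form_def Finite_Cartesian_Product.vec_eq_iff distrib_right sum.distrib add_divide_distrib)
    show "form x (r *\<^sub>R y) = r *\<^sub>R form x y" for x y r
      by (simp add: form_def Finite_Cartesian_Product.vec_eq_iff t2 complex_eq_iff
          flip: scaleR_sum_right)
    show "form (r *\<^sub>R x) y = r *\<^sub>R form x y" for x y r
      by (simp add: form_def Finite_Cartesian_Product.vec_eq_iff complex_eq_iff
          flip: scaleR_sum_right)
  qed
qed

sublocale quadratic_graph form T0 T0_proj
proof (unfold quadratic_graph_def quadratic_graph_axioms_def, intro conjI allI impI)
  show "bounded_bilinear form" using bilinear_form bilinear_conv_bounded_bilinear by blast
  show "Real_Vector_Spaces.subspace T0" by (rule subspace_T0)
  show "linear T0_proj" unfolding T0_proj_def[abs_def]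
    by (intro linear_compose_add linear_parts)
  show "T0_proj x \<in> T0" for x using part by (auto simp: T0_def T0_proj_component)
  show "T0_proj x = x" if "x \<in> T0" for x
  proof -
    have "T0_proj x $h i = x $h i" for i
      by (cases rule: index_cases[of i]) (use that in \<open>auto simp: T0_def T0_proj_component complex_eq_iff\<close>)
    then show ?thesis by (simp add: Finite_Cartesian_Product.vec_eq_iff)
  qed
  show "x - T0_proj x \<in> orthogonal_comp T0" for x
    using part by (auto simp: orthogonal_comp_T0 T0_proj_component)
  show "form x y \<in> orthogonal_comp T0" for x y
    using part by (auto simp: orthogonal_comp_T0 form_def)
  show "form (T0_proj x) (T0_proj y) = form x y" for x y
  proof -
    have z: "T0_proj x $h i = x $h i" if "i \<in> Z" for x i using that by (simp add: T0_proj_component)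
    have w: "Im (T0_proj x $h i) = Im (x $h i)" if "i \<in> W" for x i
      using that part by (auto simp: T0_proj_component)
    have "t_coeff (T0_proj y) j = t_coeff y j" for j by (simp add: t_coeff_def z w cong: sum.cong)
    then show ?thesis
      by (auto simp: form_def z Finite_Cartesian_Product.vec_eq_iff cong: sum.cong)
  qed
qed

text \<open>The vector \<open>B z + C z' + D v\<close>, with \<open>z'\<close> the conjugate of
  \<open>z\<close>. Unlike in \<open>t_coeff\<close>, the coefficient of \<open>C\<close> is
  \<open>1\<close>.\<close>

definition normal_variation :: "complex^'n \<Rightarrow> 'n \<Rightarrow> complex" where
  "normal_variation \<xi> i = (\<Sum>k\<in>Z. Bm i k * \<xi> $h k) + (\<Sum>k\<in>Z. Cm i k * cnj (\<xi> $h k))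
     + (\<Sum>k\<in>W. Dm i k * of_real (Im (\<xi> $h k)))"

text \<open>With \<open>\<xi>\<close> in the conjugated slot, the \<open>B\<close> term is complex
  linear in the test vector and drops out, while symmetry of \<open>C\<close> yields one half of the
  \<open>C\<close> term. With \<open>\<xi>\<close> in the other slot all of \<open>t_coeff\<close>
  survives, including the other half.\<close>

lemma antilinear_part_shape:
  assumes i: "i \<in> Z"
  shows "antilinear_part (shape \<xi>) $h i = - 2 * \<i> * normal_variation \<xi> i"
proof -
  have iW: "i \<notin> W" using i part by auto
  have tc: "t_coeff (axis i c) j = Bm j i * c + 1/2 * (Cm j i * cnj c)" for c j
  proof -
    have "(\<Sum>k\<in>Z. Bm j k * axis i c $h k) = (\<Sum>k\<in>Z. if k = i then Bm j i * c else 0)"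
      by (intro sum.cong) (auto simp: axis_def)
    moreover have "(\<Sum>k\<in>Z. Cm j k * cnj (axis i c $h k)) = (\<Sum>k\<in>Z. if k = i then Cm j i * cnj c else 0)"
      by (intro sum.cong) (auto simp: axis_def)
    moreover have "(\<Sum>k\<in>W. Dm j k * of_real (Im (axis i c $h k))) = 0"
      using iW by (intro sum.neutral) (auto simp: axis_def)
    ultimately show ?thesis using i by (simp add: t_coeff_def)
  qed
  have f1: "form \<xi> (axis i c) $h t = (\<Sum>j\<in>Z. cnj (\<xi> $h j) * (Bm j i * c + 1/2 * (Cm j i * cnj c)))" for c
    using part by (simp add: form_def tc)
  have f2: "form (axis i c) \<xi> $h t = cnj c * t_coeff \<xi> i" for c
  proof -
    have "form (axis i c) \<xi> $h t = (\<Sum>j\<in>Z. cnj (axis i c $h j) * t_coeff \<xi> j)"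
      using part by (simp add: form_def)
    also have "\<dots> = (\<Sum>j\<in>Z. if j = i then cnj c * t_coeff \<xi> i else 0)"
      by (intro sum.cong) (auto simp: axis_def)
    finally show ?thesis using i by simp
  qed
  have sym: "(\<Sum>k\<in>Z. Cm i k * cnj (\<xi> $h k)) = (\<Sum>j\<in>Z. cnj (\<xi> $h j) * Cm j i)"
    using i Cm_sym by (intro sum.cong) auto
  have "antilinear_part (shape \<xi>) $h i
      = (\<Sum>j\<in>Z. cnj (\<xi> $h j) * (Bm j i * \<i> + 1/2 * (Cm j i * cnj \<i>)))
        - \<i> * (\<Sum>j\<in>Z. cnj (\<xi> $h j) * (Bm j i * 1 + 1/2 * (Cm j i * cnj 1))) - 2 * \<i> * t_coeff \<xi> i"
    using i by (simp add: antilinear_part_def shape_apply f1 f2 algebra_simps)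
  also have "(\<Sum>j\<in>Z. cnj (\<xi> $h j) * (Bm j i * \<i> + 1/2 * (Cm j i * cnj \<i>)))
        - \<i> * (\<Sum>j\<in>Z. cnj (\<xi> $h j) * (Bm j i * 1 + 1/2 * (Cm j i * cnj 1)))
      = - \<i> * (\<Sum>j\<in>Z. cnj (\<xi> $h j) * Cm j i)"
    unfolding sum_distrib_left sum_subtractf[symmetric]
    by (intro sum.cong) (auto simp: algebra_simps)
  also have "- \<i> * (\<Sum>j\<in>Z. cnj (\<xi> $h j) * Cm j i) - 2 * \<i> * t_coeff \<xi> i = - 2 * \<i> * normal_variation \<xi> i"
    unfolding t_coeff_def normal_variation_def sym by (simp add: algebra_simps)
  finally show ?thesis .
qed

text \<open>Transversality says that the antilinear part maps \<open>shape\<close> followed by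
  \<open>T0\<close> onto the normal space; the factor \<open>- 2 * \<i>\<close> does not affect
  surjectivity.\<close>

theorem transversal_iff:
  "grass_transversal_at (2 * card Z + card W) graph_set (gauss_map graph_set)
      (Grass_CR (card Z) (card W)) 0 \<longleftrightarrow>
    (\<forall>c. \<exists>\<xi>\<in>T0. \<forall>i\<in>Z. normal_variation \<xi> i = c i)"
proof -
  have d: "grass_differential graph_set (gauss_map graph_set) 0 ` tangent_space graph_set 0 = shape ` T0"
    by (simp add: tangent_space_0 grass_differential_gauss_map cong: image_cong)
  have g0: "gauss_map graph_set 0 = T0" by (simp add: gauss_map_def tangent_space_0)
  have T0_Grass: "T0 \<in> Grass (2 * card Z + card W)"
    using T0_in_Grass_CR by (simp add: Grass_CR_def)
  have "Real_Vector_Spaces.subspace (shape ` T0)"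
    using bounded_linear_shape subspace_T0
    by (intro Real_Vector_Spaces.linear_subspace_image) (auto simp: bounded_linear.linear)
  then have "grass_transversal_at (2 * card Z + card W) graph_set (gauss_map graph_set)
      (Grass_CR (card Z) (card W)) 0 \<longleftrightarrow>
      antilinear_part ` (shape ` T0) = {c. \<forall>i. i \<notin> Z \<longrightarrow> c $h i = 0}"
    unfolding grass_transversal_at_def d g0
      grass_tangent_space_Grass[OF T0_Grass] grass_tangent_space_Grass_CR antilinear_part_image[symmetric]
    using shape_in_grass_hom
    by (intro span_Un_kernel_eq_iff subspace_grass_hom linear_antilinear_part) auto
  also have "\<dots> \<longleftrightarrow> (\<forall>c. \<exists>\<xi>\<in>T0. \<forall>i\<in>Z. normal_variation \<xi> i = c i)"
  proof
    assume *: "antilinear_part ` (shape ` T0) = {c. \<forall>i. i \<notin> Z \<longrightarrow> c $h i = 0}"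
    show "\<forall>c. \<exists>\<xi>\<in>T0. \<forall>i\<in>Z. normal_variation \<xi> i = c i"
    proof
      fix c :: "'n \<Rightarrow> complex"
      have "(\<chi> i. if i \<in> Z then - 2 * \<i> * c i else 0) \<in> antilinear_part ` (shape ` T0)"
        unfolding * by simp
      then obtain \<xi> where \<xi>: "\<xi> \<in> T0"
        "(\<chi> i. if i \<in> Z then - 2 * \<i> * c i else 0) = antilinear_part (shape \<xi>)" by blast
      have "normal_variation \<xi> i = c i" if "i \<in> Z" for i
        using arg_cong[OF \<xi>(2), of "\<lambda>v. v $h i"] that by (simp add: antilinear_part_shape)
      then show "\<exists>\<xi>\<in>T0. \<forall>i\<in>Z. normal_variation \<xi> i = c i" using \<xi>(1) by blast
    qed
  next
    assume *: "\<forall>c. \<exists>\<xi>\<in>T0. \<forall>i\<in>Z. normal_variation \<xi> i = c i"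
    show "antilinear_part ` (shape ` T0) = {c. \<forall>i. i \<notin> Z \<longrightarrow> c $h i = 0}"
    proof (intro equalityI subsetI)
      fix c :: "complex^'n" assume c: "c \<in> {c. \<forall>i. i \<notin> Z \<longrightarrow> c $h i = 0}"
      obtain \<xi> where \<xi>: "\<xi> \<in> T0" "\<And>i. i \<in> Z \<Longrightarrow> normal_variation \<xi> i = \<i> / 2 * c $h i"
        using *[rule_format, of "\<lambda>i. \<i> / 2 * c $h i"] by blast
      have "antilinear_part (shape \<xi>) $h i = c $h i" for i
      proof (cases "i \<in> Z")
        case True then show ?thesis by (simp add: antilinear_part_shape \<xi>(2))
      next
        case False then show ?thesis using c by (simp add: antilinear_part_def)
      qed
      then have "antilinear_part (shape \<xi>) = c" by (simp add: Finite_Cartesian_Product.vec_eq_iff)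
      then show "c \<in> antilinear_part ` (shape ` T0)" using \<xi>(1) by blast
    qed (auto simp: antilinear_part_def)
  qed
  finally show ?thesis .
qed

end

section \<open>Rank and surjectivity\<close>

text \<open>Full row rank means that the columns span. The rank is the size of a maximal independent
  set of columns, and \<open>n\<close> independent vectors in dimension \<open>n\<close> form a
  basis.\<close>

lemma (in vec_space) rank_eq_n_iff_surj:
  assumes A: "A \<in> carrier_mat n nc"
  shows "rank A = n \<longleftrightarrow> (\<forall>y\<in>carrier_vec n. \<exists>x\<in>carrier_vec nc. A *\<^sub>v x = y)"
proof -
  have cols: "set (cols A) \<subseteq> carrier_vec n" using cols_dim A by blast
  have col: "col_space A = {y\<in>carrier_vec n. \<exists>x\<in>carrier_vec nc. A *\<^sub>v x = y}"
    using col_space_eq[OF A] A by auto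
  have "rank A = n \<longleftrightarrow> col_space A = carrier_vec n"
  proof
    assume r: "rank A = n"
    obtain S where S: "maximal S (\<lambda>T. T \<subseteq> set (cols A) \<and> lin_indpt T)" "finite S"
      using maximal_exists_superset[of "set (cols A)" "\<lambda>T. T \<subseteq> set (cols A) \<and> lin_indpt T" "{}"]
        lin_dep_def by auto
    then have SA: "S \<subseteq> set (cols A)" and li: "lin_indpt S" by (auto simp: maximal_def)
    have "card S = n" using rank_card_indpt[OF A S(1)] r by simp
    then have "basis S"
      using SA cols li S(2) dim_is_n by (intro dim_li_is_basis) auto
    then have "span S = carrier_vec n" by (simp add: basis_def)
    moreover have "span S \<subseteq> col_space A" unfolding col_space_def using SA by (rule span_is_monotone)
    ultimately show "col_space A = carrier_vec n" using col by blast
  next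
    assume c: "col_space A = carrier_vec n"
    have "vs (carrier_vec n) = V" by (simp add: module_vec_def)
    then show "rank A = n"
      by (simp only: rank_def col_space_def[symmetric] c dim_is_n)
  qed
  then show ?thesis unfolding col by blast
qed

lemma mult_append_cols:
  fixes A B :: "'a::comm_semiring_1 mat"
  assumes "A \<in> carrier_mat nr n1" "B \<in> carrier_mat nr n2" "x \<in> carrier_vec n1" "y \<in> carrier_vec n2"
  shows "(A @\<^sub>c B) *\<^sub>v (x @\<^sub>v y) = A *\<^sub>v x + B *\<^sub>v y"
proof -
  have dims: "dim_col A = n1" "dim_col B = n2" using assms by auto
  have "(A @\<^sub>c B) *\<^sub>v (x @\<^sub>v y)
      = (A *\<^sub>v x + B *\<^sub>v y) @\<^sub>v (0\<^sub>m 0 n1 *\<^sub>v x + 0\<^sub>m 0 n2 *\<^sub>v y)"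
    unfolding append_cols_def dims
    by (rule four_block_mat_mult_vec[OF assms(1,2) zero_carrier_mat zero_carrier_mat assms(3,4)])
  also have "\<dots> = A *\<^sub>v x + B *\<^sub>v y"
    using assms(1,2) by (intro eq_vecI) simp_all
  finally show ?thesis .
qed

lemma append_cols_carrier:
  "A \<in> carrier_mat nr n1 \<Longrightarrow> B \<in> carrier_mat nr n2 \<Longrightarrow> A @\<^sub>c B \<in> carrier_mat nr (n1 + n2)"
  by (rule carrier_matI) (auto simp: append_cols_def)

section \<open>The quadric in coordinates\<close>

lemma mult_mat_vec_cscalar_prod:
  fixes A :: "complex mat"
  assumes "A \<in> carrier_mat m p" "u \<in> carrier_vec p" "z \<in> carrier_vec m"
  shows "(A *\<^sub>v u) \<bullet>c z = (\<Sum>j<m. cnj (z $ j) * (\<Sum>k<p. A $$ (j, k) * u $ k))"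
  using assms
  by (auto simp: scalar_prod_def atLeast0LessThan mult.commute conjugate_complex_def intro!: sum.cong)

lemma mat_adjoint_eq_index:
  assumes A: "A \<in> carrier_mat m m" and adj: "mat_adjoint A = A" and "i < m" "j < m"
  shows "cnj (A $$ (i, j)) = A $$ (j, i)"
proof -
  have "mat_adjoint A $$ (j, i) = cnj (A $$ (i, j))"
    using assms(1,3,4) unfolding mat_adjoint_def by (simp add: mat_of_rows_def conjugate_complex_def)
  then show ?thesis using adj by simp
qed

text \<open>The form equals its own conjugate after the two sums are exchanged.\<close>

lemma hermitian_form_real:
  fixes a :: "'a \<Rightarrow> 'a \<Rightarrow> complex"
  assumes "\<And>j k. j \<in> I \<Longrightarrow> k \<in> I \<Longrightarrow> cnj (a j k) = a k j"
  shows "Im (\<Sum>j\<in>I. cnj (z j) * (\<Sum>k\<in>I. a j k * z k)) = 0"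
proof -
  let ?s = "\<Sum>j\<in>I. cnj (z j) * (\<Sum>k\<in>I. a j k * z k)"
  have "cnj ?s = (\<Sum>j\<in>I. \<Sum>k\<in>I. z j * (cnj (a j k) * cnj (z k)))"
    by (simp add: sum_distrib_left)
  also have "\<dots> = (\<Sum>j\<in>I. \<Sum>k\<in>I. z j * (a k j * cnj (z k)))"
    using assms by (intro sum.cong) auto
  also have "\<dots> = (\<Sum>k\<in>I. \<Sum>j\<in>I. z j * (a k j * cnj (z k)))" by (rule sum.swap)
  also have "\<dots> = ?s" by (simp add: sum_distrib_left mult_ac)
  finally have "cnj ?s = ?s" .
  moreover have "Im x = 0" if "cnj x = x" for x
    using arg_cong[OF that, of Im] by simp
  ultimately show ?thesis by blast
qed

theorem proposition7p7:
  fixes m h k n :: nat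
    and idx :: "nat \<Rightarrow> 'n::finite"
    and H :: "nat \<Rightarrow> complex mat"
    and B C D :: "complex mat"
    and M :: "(complex^'n) set"
    and F G P Q R S :: "real mat"
  assumes "m \<ge> 1" and "k = h + 2" and "n = m + h + 1"
    and "bij_betw idx {..<n} (UNIV :: 'n set)"
    and "\<And>j. j < h \<Longrightarrow> H j \<in> carrier_mat m m"
    and "\<And>j. j < h \<Longrightarrow> mat_adjoint (H j) = H j"
    and "F \<in> carrier_mat m m" and "G \<in> carrier_mat m m"
    and "P \<in> carrier_mat m m" and "Q \<in> carrier_mat m m"
    and "R \<in> carrier_mat m h" and "S \<in> carrier_mat m h"
    and "B = map_mat complex_of_real F + \<i> \<cdot>\<^sub>m map_mat complex_of_real G"
    and "C = map_mat complex_of_real P + \<i> \<cdot>\<^sub>m map_mat complex_of_real Q"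
    and "D = map_mat complex_of_real R + \<i> \<cdot>\<^sub>m map_mat complex_of_real S"
    and "transpose_mat C = C"
    and "M = quadric idx m h H B C D"
  shows "grass_transversal_at (2 * n - k) M (gauss_map M) (Grass_CR m h) 0 \<longleftrightarrow>
         vec_space.rank (2 * m)
           (((F + P) @\<^sub>c (Q - G) @\<^sub>c R) @\<^sub>r ((G + Q) @\<^sub>c (F - P) @\<^sub>c S)) = 2 * m"
proof -
  note H = assms(5,6) and FG = assms(7,8) and PQ = assms(9,10) and RS = assms(11,12)
    and BCD = assms(13,14,15) and n = assms(3)
  have BC: "B \<in> carrier_mat m m" "C \<in> carrier_mat m m" "D \<in> carrier_mat m h"
    using FG PQ RS BCD by auto
  \<comment> \<open>The inverse enumeration turns matrices with numeric indices into families over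
    the index type. The \<open>w\<close>-indices have positions from \<open>m\<close> on, hence the
    shifts by \<open>m\<close> in \<open>Hm\<close> and \<open>Dm\<close>.\<close>
  define pos where "pos = the_inv_into {..<n} idx"
  have pos: "pos (idx j) = j" if "j < n" for j
    using assms(4) that by (simp add: pos_def the_inv_into_f_f bij_betw_def)
  have idx_inj: "idx i = idx j \<Longrightarrow> i < n \<Longrightarrow> j < n \<Longrightarrow> i = j" for i j using pos by metis
  have idx_surj: "\<exists>j<n. i = idx j" for i using assms(4) by (auto simp: bij_betw_def)
  define Z where "Z = idx ` {..<m}"
  define W where "W = (\<lambda>j. idx (m + j)) ` {..<h}"
  define t where "t = idx (m + h)"
  have inj: "inj_on idx {..<m}" "inj_on (\<lambda>j. idx (m + j)) {..<h}"
    using idx_inj n by (auto simp: inj_on_def dest!: idx_inj)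
  have card: "card Z = m" "card W = h" using inj by (simp_all add: Z_def W_def card_image)
  have sumZ: "(\<Sum>i\<in>Z. f i) = (\<Sum>j<m. f (idx j))" for f :: "'n \<Rightarrow> complex"
    unfolding Z_def using sum.reindex[OF inj(1)] by simp
  have sumW: "(\<Sum>i\<in>W. f i) = (\<Sum>j<h. f (idx (m + j)))" for f :: "'n \<Rightarrow> complex"
    unfolding W_def using sum.reindex[OF inj(2)] by simp
  have Z_iff: "idx j \<in> Z \<longleftrightarrow> j < m" if "j < n" for j using idx_inj that n by (force simp: Z_def)
  have W_iff: "idx j \<in> W \<longleftrightarrow> m \<le> j \<and> j < m + h" if j: "j < n" for j
  proof
    assume "idx j \<in> W"
    then obtain l where "l < h" "idx j = idx (m + l)" by (auto simp: W_def)
    then show "m \<le> j \<and> j < m + h" using idx_inj[of j "m + l"] j n by auto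
  next
    assume "m \<le> j \<and> j < m + h"
    then have "j = m + (j - m)" "j - m < h" by auto
    then show "idx j \<in> W" unfolding W_def by (metis imageI lessThan_iff)
  qed
  have t_iff: "idx j = t \<longleftrightarrow> j = m + h" if "j < n" for j using idx_inj that n by (auto simp: t_def)
  define Hm where "Hm i j k = H (pos i - m) $$ (pos j, pos k)" for i j k
  define Bm where "Bm i j = B $$ (pos i, pos j)" for i j
  define Cm where "Cm i j = C $$ (pos i, pos j)" for i j
  define Dm where "Dm i j = D $$ (pos i, pos j - m)" for i j
  interpret cr_quadric Z W t Hm Bm Cm Dm
  proof
    show "Z \<union> W \<union> {t} = UNIV"
    proof (intro equalityI subsetI)
      fix i :: 'n
      obtain j where "j < n" "i = idx j" using idx_surj by blast
      then show "i \<in> Z \<union> W \<union> {t}" using n by (auto simp: Z_iff W_iff t_iff)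
    qed simp
    show "Z \<inter> W = {}"
    proof (intro equals0I)
      fix i assume i: "i \<in> Z \<inter> W"
      obtain j where "j < n" "i = idx j" using idx_surj by blast
      then show False using i by (auto simp: Z_iff W_iff)
    qed
    show "t \<notin> Z" "t \<notin> W" using n by (auto simp: t_def Z_iff W_iff)
    show "Cm i j = Cm j i" if "i \<in> Z" "j \<in> Z" for i j
    proof -
      have ij: "pos i < m" "pos j < m" using that pos n by (auto simp: Z_def)
      have "C $$ (pos i, pos j) = transpose_mat C $$ (pos j, pos i)" using ij BC by simp
      then show ?thesis using assms(16) by (simp add: Cm_def)
    qed
  qed
  have M: "M = graph_set"
  proof (rule Set.set_eqI)
    fix x :: "complex^'n"
    define hq where "hq l = (\<Sum>j<m. cnj (x $h idx j) * (\<Sum>k<m. H l $$ (j, k) * x $h idx k))" for l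
    have hq: "(\<Sum>j\<in>Z. cnj (x $h j) * (\<Sum>k\<in>Z. Hm (idx (m + l)) j k * x $h k)) = hq l" if "l < h" for l
      using that n by (simp add: sumZ hq_def Hm_def pos)
    \<comment> \<open>Hermitian symmetry makes the complex equation for \<open>w\<close> equivalent
      to its real part, which is what \<open>form\<close> records.\<close>
    have Im_hq: "Im (hq l) = 0" if "l < h" for l
      unfolding hq_def using mat_adjoint_eq_index[OF H[OF that]]
      by (intro hermitian_form_real) auto
    have tc: "t_coeff x (idx j) = (\<Sum>k<m. B $$ (j, k) * x $h idx k)
        + 1/2 * (\<Sum>k<m. C $$ (j, k) * cnj (x $h idx k))
        + (\<Sum>k<h. D $$ (j, k) * of_real (Im (x $h idx (m + k))))" if "j < m" for j
      using that n by (simp add: t_coeff_def sumZ sumW Bm_def Cm_def Dm_def pos)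
    have z: "z_coord idx m x \<in> carrier_vec m" "conjugate (z_coord idx m x) \<in> carrier_vec m"
      and v: "map_vec (\<lambda>a. complex_of_real (Im a)) (w_coord idx m h x) \<in> carrier_vec h"
      by (auto simp: z_coord_def w_coord_def)
    have "x \<in> M \<longleftrightarrow> (\<forall>j<h. x $h idx (m + j) + cnj (x $h idx (m + j)) = hq j) \<and>
        x $h t = (\<Sum>j<m. cnj (x $h idx j) * t_coeff x (idx j))"
      unfolding assms(17) quadric_def Let_def mem_Collect_eq
        mult_mat_vec_cscalar_prod[OF BC(1) z(1) z(1)] mult_mat_vec_cscalar_prod[OF BC(2) z(2) z(1)]
        mult_mat_vec_cscalar_prod[OF BC(3) v z(1)]
      using mult_mat_vec_cscalar_prod[OF H(1) z(1) z(1)]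
      by (simp add: z_coord_def w_coord_def t_coord_def t_def[symmetric] tc hq_def conjugate_complex_def
          distrib_left sum.distrib sum_distrib_left mult_ac cong: conj_cong)
    also have "\<dots> \<longleftrightarrow> (\<forall>i. x $h i - T0_proj x $h i = form x x $h i)"
    proof
      assume *: "(\<forall>j<h. x $h idx (m + j) + cnj (x $h idx (m + j)) = hq j) \<and>
        x $h t = (\<Sum>j<m. cnj (x $h idx j) * t_coeff x (idx j))"
      show "\<forall>i. x $h i - T0_proj x $h i = form x x $h i"
      proof
        fix i
        show "x $h i - T0_proj x $h i = form x x $h i"
        proof (cases rule: index_cases[of i])
          case 1 then show ?thesis by (simp add: T0_proj_component form_def)
        next
          case 2
          then obtain j where j: "j < h" "i = idx (m + j)" by (auto simp: W_def)
          have "x $h i + cnj (x $h i) = hq j" using * j by simp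
          then have "Re (hq j) = 2 * Re (x $h i)" by (simp add: complex_eq_iff)
          then show ?thesis using 2 j hq by (simp add: T0_proj_component form_def complex_eq_iff)
        next
          case 3 then show ?thesis using * by (simp add: T0_proj_component form_def sumZ)
        qed
      qed
    next
      assume *: "\<forall>i. x $h i - T0_proj x $h i = form x x $h i"
      have "x $h idx (m + j) + cnj (x $h idx (m + j)) = hq j" if j: "j < h" for j
      proof -
        have W: "idx (m + j) \<in> W" "idx (m + j) \<notin> Z" using j part by (auto simp: W_def)
        then have "x $h idx (m + j) - \<i> * Im (x $h idx (m + j)) = of_real (Re (hq j) / 2)"
          using *[rule_format, of "idx (m + j)"] hq[OF j] by (simp add: T0_proj_component form_def)
        then show ?thesis using Im_hq[OF j] by (simp add: complex_eq_iff)
      qed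
      moreover have "x $h t = (\<Sum>j<m. cnj (x $h idx j) * t_coeff x (idx j))"
        using *[rule_format, of t] part by (simp add: T0_proj_component form_def sumZ)
      ultimately show "(\<forall>j<h. x $h idx (m + j) + cnj (x $h idx (m + j)) = hq j) \<and>
        x $h t = (\<Sum>j<m. cnj (x $h idx j) * t_coeff x (idx j))" by blast
    qed
    also have "\<dots> \<longleftrightarrow> x \<in> graph_set"
      by (simp add: graph_set_def Finite_Cartesian_Product.vec_eq_iff)
    finally show "x \<in> M \<longleftrightarrow> x \<in> graph_set" .
  qed
  let ?A = "((F + P) @\<^sub>c (Q - G) @\<^sub>c R) @\<^sub>r ((G + Q) @\<^sub>c (F - P) @\<^sub>c S)"
  \<comment> \<open>Real coordinates on \<open>T0\<close>, ordered like the three block columns of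
    the matrix: real and imaginary parts of \<open>z\<close>, then \<open>v\<close>.\<close>
  define coords where "coords \<xi> = Matrix.vec m (\<lambda>j. Re (\<xi> $h idx j)) @\<^sub>v
      (Matrix.vec m (\<lambda>j. Im (\<xi> $h idx j)) @\<^sub>v Matrix.vec h (\<lambda>j. Im (\<xi> $h idx (m + j))))"
    for \<xi> :: "complex^'n"
  have coords_carrier: "coords \<xi> \<in> carrier_vec (m + (m + h))" for \<xi>
    unfolding coords_def by (intro append_carrier_vec) auto
  have blocks: "(F + P) @\<^sub>c (Q - G) @\<^sub>c R \<in> carrier_mat m (m + (m + h))"
    "(G + Q) @\<^sub>c (F - P) @\<^sub>c S \<in> carrier_mat m (m + (m + h))"
    using FG PQ RS by (auto intro!: append_cols_carrier)
  then have A: "?A \<in> carrier_mat (2 * m) (m + (m + h))"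
    using carrier_append_rows[OF blocks] by (simp add: mult_2)
  \<comment> \<open>The two block rows are the real and imaginary parts of
    \<open>B z + C z' + D v\<close>; the signs come from \<open>\<i>\<close> squared and from the
    conjugation in \<open>z'\<close>.\<close>
  have A_coords: "?A *\<^sub>v coords \<xi> = Matrix.vec m (\<lambda>j. Re (normal_variation \<xi> (idx j))) @\<^sub>v
      Matrix.vec m (\<lambda>j. Im (normal_variation \<xi> (idx j)))" for \<xi>
  proof -
    have nv: "normal_variation \<xi> (idx i) =
        (\<Sum>k<m. (of_real (F $$ (i, k)) + \<i> * of_real (G $$ (i, k))) * \<xi> $h idx k)
        + (\<Sum>k<m. (of_real (P $$ (i, k)) + \<i> * of_real (Q $$ (i, k))) * cnj (\<xi> $h idx k))
        + (\<Sum>k<h. (of_real (R $$ (i, k)) + \<i> * of_real (S $$ (i, k))) * of_real (Im (\<xi> $h idx (m + k))))"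
      if "i < m" for i
      unfolding normal_variation_def sumZ sumW
      using that n BCD FG PQ RS
      by (intro arg_cong2[where f = "(+)"] sum.cong) (auto simp: Bm_def Cm_def Dm_def pos)
    have prod: "(X *\<^sub>v Matrix.vec p f) $ i = (\<Sum>k<p. X $$ (i, k) * f k)"
      if "X \<in> carrier_mat m p" "i < m" for X :: "real mat" and p f i
      using that by (simp add: scalar_prod_def atLeast0LessThan)
    have mult: "(X @\<^sub>c Y @\<^sub>c U) *\<^sub>v coords \<xi> = X *\<^sub>v Matrix.vec m (\<lambda>j. Re (\<xi> $h idx j)) +
        (Y *\<^sub>v Matrix.vec m (\<lambda>j. Im (\<xi> $h idx j)) + U *\<^sub>v Matrix.vec h (\<lambda>j. Im (\<xi> $h idx (m + j))))"
      if "X \<in> carrier_mat m m" "Y \<in> carrier_mat m m" "U \<in> carrier_mat m h" for X Y U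
      unfolding coords_def
      by (subst mult_append_cols[OF that(1) append_cols_carrier[OF that(2,3)]])
        (auto simp: mult_append_cols[OF that(2,3)])
    have blk: "F + P \<in> carrier_mat m m" "Q - G \<in> carrier_mat m m"
      "G + Q \<in> carrier_mat m m" "F - P \<in> carrier_mat m m"
      using FG PQ by auto
    have "((F + P) @\<^sub>c (Q - G) @\<^sub>c R) *\<^sub>v coords \<xi> = Matrix.vec m (\<lambda>j. Re (normal_variation \<xi> (idx j)))"
      unfolding mult[OF blk(1,2) RS(1)] using FG PQ RS blk
      by (intro eq_vecI)
        (auto simp: prod nv ring_distribs sum.distrib sum_subtractf sum_negf simp del: index_mult_mat_vec)
    moreover have "((G + Q) @\<^sub>c (F - P) @\<^sub>c S) *\<^sub>v coords \<xi> = Matrix.vec m (\<lambda>j. Im (normal_variation \<xi> (idx j)))"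
      unfolding mult[OF blk(3,4) RS(2)] using FG PQ RS blk
      by (intro eq_vecI)
        (auto simp: prod nv ring_distribs sum.distrib sum_subtractf sum_negf simp del: index_mult_mat_vec)
    ultimately show ?thesis using mat_mult_append[OF blocks coords_carrier] by simp
  qed
  have "(\<forall>c. \<exists>\<xi>\<in>T0. \<forall>i\<in>Z. normal_variation \<xi> i = c i) \<longleftrightarrow>
      (\<forall>y\<in>carrier_vec (2 * m). \<exists>x\<in>carrier_vec (m + (m + h)). ?A *\<^sub>v x = y)"
  proof (intro iffI ballI allI)
    fix y :: "real Matrix.vec"
    assume *: "\<forall>c. \<exists>\<xi>\<in>T0. \<forall>i\<in>Z. normal_variation \<xi> i = c i" and y: "y \<in> carrier_vec (2 * m)"
    obtain \<xi> where \<xi>: "\<And>i. i \<in> Z \<Longrightarrow> normal_variation \<xi> i = Complex (y $ pos i) (y $ (m + pos i))"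
      using *[rule_format, of "\<lambda>i. Complex (y $ pos i) (y $ (m + pos i))"] by blast
    have "?A *\<^sub>v coords \<xi> = y"
      unfolding A_coords using y n by (intro eq_vecI) (auto simp: \<xi> Z_iff pos)
    then show "\<exists>x\<in>carrier_vec (m + (m + h)). ?A *\<^sub>v x = y" using coords_carrier by blast
  next
    fix c :: "'n \<Rightarrow> complex"
    assume *: "\<forall>y\<in>carrier_vec (2 * m). \<exists>x\<in>carrier_vec (m + (m + h)). ?A *\<^sub>v x = y"
    have "Matrix.vec m (\<lambda>j. Re (c (idx j))) @\<^sub>v Matrix.vec m (\<lambda>j. Im (c (idx j))) \<in> carrier_vec (2 * m)"
      by (simp add: mult_2)
    then obtain x where x: "x \<in> carrier_vec (m + (m + h))"
      and Ax: "?A *\<^sub>v x = Matrix.vec m (\<lambda>j. Re (c (idx j))) @\<^sub>v Matrix.vec m (\<lambda>j. Im (c (idx j)))"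
      using * by blast
    \<comment> \<open>Inverts \<open>coords\<close>. The offset \<open>m + pos i\<close> is the same
      in both cases, since \<open>pos i\<close> already contains a shift by \<open>m\<close> when
      \<open>i\<close> is in \<open>W\<close>.\<close>
    define \<xi> :: "complex^'n" where "\<xi> = (\<chi> i. if i \<in> Z then Complex (x $ pos i) (x $ (m + pos i))
      else if i \<in> W then Complex 0 (x $ (m + pos i)) else 0)"
    have "\<xi> \<in> T0" using part by (auto simp: T0_def \<xi>_def)
    have "coords \<xi> = x"
      using x n by (intro eq_vecI) (auto simp: coords_def \<xi>_def Z_iff W_iff pos)
    then have e: "Matrix.vec m (\<lambda>j. Re (normal_variation \<xi> (idx j))) @\<^sub>v
        Matrix.vec m (\<lambda>j. Im (normal_variation \<xi> (idx j)))
        = Matrix.vec m (\<lambda>j. Re (c (idx j))) @\<^sub>v Matrix.vec m (\<lambda>j. Im (c (idx j)))"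
      using Ax A_coords by metis
    have "normal_variation \<xi> (idx j) = c (idx j)" if "j < m" for j
      using arg_cong[OF e, of "\<lambda>v. v $ j"] arg_cong[OF e, of "\<lambda>v. v $ (m + j)"] that
      by (simp add: complex_eq_iff)
    then show "\<exists>\<xi>\<in>T0. \<forall>i\<in>Z. normal_variation \<xi> i = c i" using \<open>\<xi> \<in> T0\<close> by (auto simp: Z_def)
  qed
  moreover have "2 * n - k = 2 * m + h" using n assms(2) by simp
  ultimately show ?thesis
    using transversal_iff by (simp only: card M vec_space.rank_eq_n_iff_surj[OF A])
qed

end
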